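(* Let $-\pi/2<\alpha<\pi/2$ and $\lambda<1$. Then the set of $\gamma\in\mathbb{C}$ such that $J_\gamma[f]\in\mathcal{S}$ for every $f\in\mathcal{S}^*_\alpha(\lambda)$ equals $$\bigg\{\gamma\in\mathbb{C}:\, |\gamma|\leq\frac{1}{2(1-\lambda)\cos\alpha}\bigg\} \bigcup \bigg[\frac{e^{i\alpha}}{2(1-\lambda)\cos\alpha},\frac{3e^{i\alpha}}{2(1-\lambda)\cos\alpha}\bigg].$$
   Context: $\mathbb{D}$ is the open unit disk; $\mathcal{A}$ the class of analytic $f$ on $\mathbb{D}$ with $f(0)=0$, $f'(0)=1$; $\mathcal{S}\subset\mathcal{A}$ the univalent functions. For $\alpha\in(-\pi/2,\pi/2)$, $\lambda<1$, $\mathcal{S}^*_\alpha(\lambda)=\{f\in\mathcal{A}: f(z)\neq0 \text{ for } z\ne 0,\ \mathrm{Re}\,(e^{i\alpha}zf'(z)/f(z))>\lambda\cos\alpha \text{ on }\mathbb{D}\}$. For $\gamma\in\mathbb{C}$, $J_\gamma[f](z)=\int_0^z (f(w)/w)^\gamma\,dw$, where $(f(w)/w)^\gamma=\exp(\gamma\log(f(w)/w))$ with the branch equal to $1$ at $w=0$. For $z,w\in\mathbb{C}$, $[z,w]$ denotes the line segment joining $z$ and $w$. *)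

theory Defs
  imports "HOL-Complex_Analysis.Complex_Analysis"
begin

abbreviation unit_disk :: "complex set" where
  "unit_disk \<equiv> ball 0 1"

definition classA :: "(complex \<Rightarrow> complex) set" where
  "classA = {f. f holomorphic_on unit_disk \<and> f 0 = 0 \<and> deriv f 0 = 1}"

definition classS :: "(complex \<Rightarrow> complex) set" where
  "classS = {f. f \<in> classA \<and> inj_on f unit_disk}"

definition spirallike :: "real \<Rightarrow> real \<Rightarrow> (complex \<Rightarrow> complex) set" where
  "spirallike \<alpha> l = {f. f \<in> classA \<and> (\<forall>z\<in>unit_disk. z \<noteq> 0 \<longrightarrow> f z \<noteq> 0) \<and>
      (\<forall>z\<in>unit_disk. z \<noteq> 0 \<longrightarrow> Re (exp (\<i> * of_real \<alpha>) * z * deriv f z / f z) > l * cos \<alpha>)}"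

text \<open>f(w)/w, extended by its limit value 1 at w = 0 (f'(0) = 1).\<close>
definition quot0 :: "(complex \<Rightarrow> complex) \<Rightarrow> complex \<Rightarrow> complex" where
  "quot0 f w = (if w = 0 then 1 else f w / w)"

definition logquot :: "(complex \<Rightarrow> complex) \<Rightarrow> complex \<Rightarrow> complex" where
  "logquot f = (THE h. h holomorphic_on unit_disk \<and> h 0 = 0 \<and>
       (\<forall>w\<in>unit_disk. exp (h w) = quot0 f w) \<and> (\<forall>w. w \<notin> unit_disk \<longrightarrow> h w = 0))"

definition Jop :: "complex \<Rightarrow> (complex \<Rightarrow> complex) \<Rightarrow> complex \<Rightarrow> complex" where
  "Jop \<gamma> f z = contour_integral (linepath 0 z) (\<lambda>w. exp (\<gamma> * logquot f w))"

end

theory Submission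
  imports Defs
begin

text \<open>
  Writing \<open>log (f(z)/z) = c L\<close> with \<open>c = e\<^bsup>-i\<alpha>\<^esup> (1 - \<lambda>) cos \<alpha>\<close>, the spirallikeness of \<open>f\<close> becomes
  \<open>Re (1 + z L') > 0\<close>, that is, \<open>e\<^sup>L\<close> is the derivative of a convex function, and the derivative of
  \<open>J\<^sub>\<gamma>[f]\<close> is \<open>e\<^bsup>\<delta>L\<^esup>\<close> with \<open>\<delta> = c \<gamma>\<close>. One has to show that all these primitives are univalent iff
  \<open>\<bar>\<delta>\<bar> \<le> 1/2\<close> or \<open>\<delta> \<in> [1/2, 3/2]\<close>.

  For sufficiency, \<open>F(z) - v\<close> is deformed to a function whose only zero in the closed disk is \<open>0\<close>,
  along a reparametrised Loewner chain. The zeros stay simple and, as the deformation parameter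
  decreases, never leave the closed disk, so \<open>F\<close> takes the value \<open>v\<close> at most once. For \<open>\<bar>\<delta>\<bar> \<le> 1/2\<close> the
  chain is that of Ahlfors and Becker; for \<open>\<delta> \<in> [1/2, 3/2]\<close> the function is close-to-convex, because
  \<open>\<bar>Im L\<bar> < \<pi>\<close> by the theorem of Marx and Strohhaecker.

  For necessity, \<open>L = -2 \<mu> log (1 - z)\<close> with \<open>0 < \<mu> \<le> 1\<close> gives the primitive \<open>(1 - z)\<^sup>\<nu>\<close> up to affine maps,
  where \<open>\<nu> = 1 - 2 \<mu> \<delta>\<close>. It is not univalent if \<open>\<bar>\<nu> - 1\<bar> > 1\<close> and \<open>\<bar>\<nu> + 1\<bar> > 1\<close>, and some \<open>\<mu>\<close> achieves this
  whenever \<open>\<delta>\<close> is outside the stated set.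
\<close>

section \<open>Zeros along a deformation\<close>

text \<open>The margin \<open>\<kappa> * s\<close> leaves room in the unit disk for a whole disk
  around the displaced point. For \<open>z0\<close> on the circle the squared modulus is
  \<open>1 - 2 * m * s\<close> up to order \<open>s\<^sup>2\<close>, where
  \<open>m = - Re (cnj z0 * a)\<close>, and this beats the margin \<open>m / 2 * s\<close>.\<close>

lemma eventually_inward:
  fixes a z0 :: complex
  assumes "cmod z0 \<le> 1" and "cmod z0 = 1 \<Longrightarrow> Re (cnj z0 * a) < 0"
  obtains \<kappa> where "\<kappa> > 0" "\<forall>\<^sub>F s in at_right (0::real). cmod (z0 + of_real s * a) + \<kappa> * s \<le> 1"
proof (cases "cmod z0 = 1")
  case False
  with assms have lt: "cmod z0 < 1" by simp
  have "((\<lambda>s. cmod (z0 + of_real s * a) + 1 * s) \<longlongrightarrow> cmod (z0 + of_real 0 * a) + 1 * 0) (at_right 0)"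
    by (intro tendsto_intros)
  then have "\<forall>\<^sub>F s in at_right 0. cmod (z0 + of_real s * a) + 1 * s < 1"
    using lt by (intro order_tendstoD) auto
  then show thesis
    by (intro that[of 1]) (auto elim: eventually_mono)
next
  case True
  define m where "m = - Re (cnj z0 * a)"
  have m: "m > 0" using assms True by (simp add: m_def)
  have lim: "((\<lambda>s. s * (cmod a)\<^sup>2) \<longlongrightarrow> 0 * (cmod a)\<^sup>2) (at_right 0)" "((\<lambda>s. m / 2 * s) \<longlongrightarrow> m / 2 * 0) (at_right 0)"
    by (intro tendsto_intros)+
  have "\<forall>\<^sub>F s in at_right 0. s * (cmod a)\<^sup>2 < m" "\<forall>\<^sub>F s in at_right 0. m / 2 * s < 1"
    using order_tendstoD(2)[OF lim(1), of m] order_tendstoD(2)[OF lim(2), of 1] m by simp_all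
  moreover have "\<forall>\<^sub>F s in at_right (0::real). s > 0"
    by (rule eventually_at_right_less)
  ultimately have "\<forall>\<^sub>F s in at_right 0. cmod (z0 + of_real s * a) + m / 2 * s \<le> 1"
  proof eventually_elim
    case (elim s)
    have n1: "(Re z0)\<^sup>2 + (Im z0)\<^sup>2 = 1"
      using True by (metis cmod_power2 one_power2)
    have "(cmod (z0 + of_real s * a))\<^sup>2 = ((Re z0)\<^sup>2 + (Im z0)\<^sup>2) - 2 * m * s + s * (s * (cmod a)\<^sup>2)"
      unfolding m_def cmod_power2 by (simp add: power2_eq_square algebra_simps)
    also have "\<dots> \<le> 1 - 2 * m * s + s * m"
      using elim n1 by (simp add: mult_left_mono)
    also have "\<dots> \<le> (1 - m / 2 * s)\<^sup>2"
      by (simp add: power2_diff)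
    finally have "cmod (z0 + of_real s * a) \<le> 1 - m / 2 * s"
      by (rule power2_le_imp_le) (use elim in linarith)
    then show ?case by simp
  qed
  then show thesis
    using m by (intro that[of "m/2"]) auto
qed

text \<open>By linearisation \<open>h (t0 - s) z\<close> is close to \<open>B * (z - w)\<close> with
  \<open>w = z0 + s * a\<close> and \<open>a = A / B\<close>: backwards in \<open>t\<close> the zero
  travels with velocity \<open>a\<close>. On the circle of radius \<open>\<kappa> * s\<close> about
  \<open>w\<close> the linear part dominates the error, so the minimum modulus principle gives a
  zero inside; \<open>eventually_inward\<close> keeps that disk in the closed unit disk.\<close>

lemma simple_zero_moves_inward:
  fixes h :: "real \<Rightarrow> complex \<Rightarrow> complex"
  assumes der: "((\<lambda>x. h (fst x) (snd x)) has_derivative (\<lambda>y. of_real (fst y) * A + B * snd y)) (at (t0, z0))"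
    and hol: "\<And>t. 0 < t \<Longrightarrow> t < t0 \<Longrightarrow> continuous_on (cball 0 1) (h t) \<and> h t holomorphic_on ball 0 1"
    and "0 < t0" "h t0 z0 = 0" "B \<noteq> 0" "cmod z0 \<le> 1"
    and inward: "cmod z0 = 1 \<Longrightarrow> Re (cnj z0 * (A / B)) < 0"
    and "\<epsilon> > 0"
  shows "\<forall>\<^sub>F t in at_left t0. \<exists>z\<in>cball 0 1. dist z z0 < \<epsilon> \<and> h t z = 0"
proof -
  define a where "a = A / B"
  have A: "A = B * a" using \<open>B \<noteq> 0\<close> by (simp add: a_def)
  obtain \<kappa> where \<kappa>: "\<kappa> > 0"
    and inw: "\<forall>\<^sub>F s in at_right 0. cmod (z0 + of_real s * a) + \<kappa> * s \<le> 1"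
    using eventually_inward[OF \<open>cmod z0 \<le> 1\<close>, of a] inward unfolding a_def by blast
  \<comment> \<open>Parameter and point together move by at most \<open>M * s\<close>. The constant
    \<open>e\<close> then makes the linearisation error at most a quarter of
    \<open>cmod B * \<kappa> * s\<close>, the modulus of the linear part on the circle.\<close>
  define M where "M = 1 + cmod a + \<kappa>"
  have M: "M > 0" using \<kappa> by (simp add: M_def add_pos_nonneg)
  define e where "e = cmod B * \<kappa> / (4 * M)"
  have e: "e > 0" using \<kappa> M \<open>B \<noteq> 0\<close> by (simp add: e_def)
  obtain d where d: "d > 0" and bound: "\<And>y. norm (y - (t0, z0)) < d \<Longrightarrow>
      norm (h (fst y) (snd y) - (of_real (fst y - t0) * A + B * (snd y - z0))) \<le> e * norm (y - (t0, z0))"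
    using der e \<open>h t0 z0 = 0\<close> unfolding has_derivative_at_alt by fastforce
  have "((\<lambda>s. M * s) \<longlongrightarrow> M * 0) (at_right 0)"
    by (intro tendsto_intros)
  then have "\<forall>\<^sub>F s in at_right 0. M * s < d" "\<forall>\<^sub>F s in at_right 0. M * s < \<epsilon>"
    using d \<open>\<epsilon> > 0\<close> by (auto intro!: order_tendstoD(2))
  moreover have "\<forall>\<^sub>F s in at_right (0::real). s > 0" "\<forall>\<^sub>F s in at_right 0. s < t0"
    using \<open>0 < t0\<close> by (auto simp: eventually_at_right[of 0 t0] eventually_at_right_less)
  ultimately have "\<forall>\<^sub>F s in at_right 0. \<exists>z\<in>cball 0 1. dist z z0 < \<epsilon> \<and> h (t0 - s) z = 0"
    using inw
  proof eventually_elim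
    case (elim s)
    define w where "w = z0 + of_real s * a"
    have near: "cmod (z - z0) \<le> (M - 1) * s" if "cmod (z - w) \<le> \<kappa> * s" for z
    proof -
      have "cmod (z - z0) = cmod ((z - w) + of_real s * a)" by (simp add: w_def)
      also have "\<dots> \<le> cmod (z - w) + s * cmod a"
        using norm_triangle_ineq[of "z - w" "of_real s * a"] elim by (simp add: norm_mult)
      finally show ?thesis using that by (simp add: M_def algebra_simps)
    qed
    have est: "cmod (h (t0 - s) z - B * (z - w)) \<le> cmod B * \<kappa> * s / 4" if z: "cmod (z - w) \<le> \<kappa> * s" for z
    proof -
      have "norm ((t0 - s, z) - (t0, z0)) \<le> norm (- s) + cmod (z - z0)"
        using sqrt_sum_squares_le_sum_abs[of "- s" "cmod (z - z0)"] by (simp add: norm_Pair)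
      also have "\<dots> \<le> M * s" using near[OF z] elim by (simp add: algebra_simps)
      finally have n: "norm ((t0 - s, z) - (t0, z0)) \<le> M * s" .
      have lin: "of_real (fst (t0 - s, z) - t0) * A + B * (snd (t0 - s, z) - z0) = B * (z - w)"
        by (simp add: A w_def algebra_simps)
      have "cmod (h (t0 - s) z - B * (z - w)) \<le> e * norm ((t0 - s, z) - (t0, z0))"
        using bound[of "(t0 - s, z)"] n elim(1) unfolding lin by simp
      also have "\<dots> \<le> e * (M * s)" using n e by (intro mult_left_mono) auto
      also have "\<dots> = cmod B * \<kappa> * s / 4" using M by (simp add: e_def)
      finally show ?thesis .
    qed
    have sub: "cball w (\<kappa> * s) \<subseteq> cball 0 1"
      using elim(5) by (simp add: w_def cball_subset_cball_iff dist_norm)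
    have sub': "ball w (\<kappa> * s) \<subseteq> ball 0 1"
      using elim(5) by (simp add: w_def ball_subset_ball_iff dist_norm)
    have "continuous_on (cball w (\<kappa> * s)) (h (t0 - s))" "h (t0 - s) holomorphic_on ball w (\<kappa> * s)"
      using hol[of "t0 - s"] elim sub sub'
      by (auto intro: continuous_on_subset holomorphic_on_subset)
    moreover have "0 < \<kappa> * s" using \<kappa> elim by simp
    moreover have "cmod (h (t0 - s) w) < cmod (h (t0 - s) z)" if "cmod (w - z) = \<kappa> * s" for z
    proof -
      have zw: "cmod (z - w) = \<kappa> * s" using that by (simp add: norm_minus_commute)
      have 1: "cmod (h (t0 - s) w) \<le> cmod B * \<kappa> * s / 4"
        using est[of w] \<kappa> elim by simp
      have "cmod (B * (z - w)) - cmod (h (t0 - s) z) \<le> cmod (h (t0 - s) z - B * (z - w))"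
        by (metis norm_minus_commute norm_triangle_ineq2)
      also have "\<dots> \<le> cmod B * \<kappa> * s / 4" using est[of z] zw by simp
      finally have "cmod B * \<kappa> * s - cmod (h (t0 - s) z) \<le> cmod B * \<kappa> * s / 4"
        using zw by (simp add: norm_mult mult.assoc)
      moreover have "cmod B * \<kappa> * s > 0" using \<kappa> elim \<open>B \<noteq> 0\<close> by simp
      ultimately show ?thesis using 1 by linarith
    qed
    ultimately obtain z where z: "z \<in> ball w (\<kappa> * s)" "h (t0 - s) z = 0"
      using holomorphic_contract_to_zero by blast
    have "cmod (z - z0) \<le> (M - 1) * s"
      using z(1) by (intro near) (simp add: dist_norm norm_minus_commute)
    also have "\<dots> < \<epsilon>" using elim by (simp add: algebra_simps)
    finally show ?case using z sub by (intro bexI[of _ z]) (auto simp: dist_norm subset_iff)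
  qed
  then obtain b where b: "b > 0" and *: "\<And>s. 0 < s \<Longrightarrow> s < b \<Longrightarrow> \<exists>z\<in>cball 0 1. dist z z0 < \<epsilon> \<and> h (t0 - s) z = 0"
    by (auto simp: eventually_at_right[of 0 1])
  have "\<exists>z\<in>cball 0 1. dist z z0 < \<epsilon> \<and> h t z = 0" if "t0 - b < t" "t < t0" for t
    using *[of "t0 - t"] that by simp
  then show ?thesis
    using b by (auto simp: eventually_at_left[of "t0 - b" t0] intro!: exI[of _ "t0 - b"])
qed


text \<open>Near \<open>(t0, z0)\<close> the derivative of \<open>h t / B t0 z0\<close> differs from
  1 by less than 1, so this map minus the identity strictly decreases distances on a convex set. One
  radius serves all nearby \<open>t\<close>, which prevents two distinct zeros from merging in a
  limit.\<close>

lemma locally_uniformly_injective: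
  fixes h :: "real \<Rightarrow> complex \<Rightarrow> complex"
  assumes der: "\<And>t z. t \<in> {0..1} \<Longrightarrow> z \<in> cball 0 1 \<Longrightarrow> (h t has_field_derivative B t z) (at z)"
    and contB: "continuous_on ({0..1} \<times> cball 0 1) (\<lambda>x. B (fst x) (snd x))"
    and "t0 \<in> {0..1}" "z0 \<in> cball 0 1" "B t0 z0 \<noteq> 0"
  obtains d where "d > 0" "\<And>t. t \<in> {0..1} \<Longrightarrow> \<bar>t - t0\<bar> < d \<Longrightarrow> inj_on (h t) (ball z0 d \<inter> cball 0 1)"
proof -
  define e where "e = cmod (B t0 z0)"
  have "e > 0" using assms by (simp add: e_def)
  then obtain d0 where d0: "d0 > 0" and close: "\<And>x. x \<in> {0..1} \<times> cball 0 1 \<Longrightarrow> dist x (t0, z0) < d0 \<Longrightarrow>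
      dist (B (fst x) (snd x)) (B t0 z0) < e"
    using contB assms(3,4) unfolding continuous_on_iff by fastforce
  show thesis
  proof (rule that[of "d0 / 2"])
    show "d0 / 2 > 0" using d0 by simp
    fix t assume t: "t \<in> {0..1}" "\<bar>t - t0\<bar> < d0 / 2"
    define S where "S = ball z0 (d0 / 2) \<inter> cball (0::complex) 1"
    have "convex S" by (simp add: S_def convex_Int)
    have near: "cmod (B t z - B t0 z0) < e" if "z \<in> S" for z
    proof -
      have "dist (t, z) (t0, z0) \<le> \<bar>t - t0\<bar> + dist z z0"
        using sqrt_sum_squares_le_sum_abs[of "t - t0" "dist z z0"]
        by (simp add: dist_Pair_Pair dist_real_def)
      also have "\<dots> < d0" using t that by (simp add: S_def dist_commute)
      finally show ?thesis using close[of "(t, z)"] t that by (auto simp: S_def dist_norm)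
    qed
    have "inj_on (\<lambda>z. h t z / B t0 z0) S"
    proof (rule inj_onI, rule ccontr)
      fix x y assume xy: "x \<in> S" "y \<in> S" "h t x / B t0 z0 = h t y / B t0 z0" "x \<noteq> y"
      define g where "g = (\<lambda>z. h t z / B t0 z0 - z)"
      have "cmod (g y - g x) < cmod (y - x)"
      proof -
        have seg: "closed_segment x y \<subseteq> S"
          using xy \<open>convex S\<close> by (simp add: closed_segment_subset)
        have "continuous_on (closed_segment x y) (\<lambda>z. cmod (B t z / B t0 z0 - 1))"
        proof -
          have "continuous_on (closed_segment x y) (\<lambda>z. B (fst (t, z)) (snd (t, z)))"
            by (rule continuous_on_compose2[OF contB]) (use seg t in \<open>auto intro!: continuous_intros simp: S_def\<close>)
          then show ?thesis using assms(5) by (auto intro!: continuous_intros)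
        qed
        then obtain m where m: "m \<in> closed_segment x y"
          "\<And>z. z \<in> closed_segment x y \<Longrightarrow> cmod (B t z / B t0 z0 - 1) \<le> cmod (B t m / B t0 z0 - 1)"
          using continuous_attains_sup[OF compact_segment, of x y "\<lambda>z. cmod (B t z / B t0 z0 - 1)"] by auto
        define q where "q = cmod (B t m / B t0 z0 - 1)"
        have "B t m / B t0 z0 - 1 = (B t m - B t0 z0) / B t0 z0" using assms(5) by (simp add: field_simps)
        then have "q < 1"
          using near[of m] m(1) seg \<open>e > 0\<close> by (auto simp: q_def e_def norm_divide)
        have "cmod (g y - g x) \<le> q * cmod (y - x)"
        proof (rule field_differentiable_bound[of "closed_segment x y"])
          fix z assume z: "z \<in> closed_segment x y"
          show "(g has_field_derivative (B t z / B t0 z0 - 1)) (at z within closed_segment x y)"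
            unfolding g_def using t seg z
            by (intro has_field_derivative_at_within[OF DERIV_diff[OF DERIV_cdivide[OF der] DERIV_ident]])
              (auto simp: S_def)
          show "cmod (B t z / B t0 z0 - 1) \<le> q" using m z by (simp add: q_def)
        qed auto
        also have "\<dots> < 1 * cmod (y - x)"
          using \<open>q < 1\<close> xy by (intro mult_strict_right_mono) simp_all
        finally show ?thesis by simp
      qed
      then show False using xy by (simp add: g_def norm_minus_commute)
    qed
    then show "inj_on (h t) (ball z0 (d0 / 2) \<inter> cball 0 1)"
      unfolding S_def inj_on_def using assms(5) by auto
  qed
qed

text \<open>\<open>A\<close> and \<open>B\<close> are the partial derivatives of \<open>h\<close> in
  \<open>t\<close> and \<open>z\<close>. The set \<open>S\<close> of parameters with two distinct
  zeros is closed by \<open>locally_uniformly_injective\<close>. At a positive infimum of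
  \<open>S\<close> both zeros would persist, still separate, for slightly smaller parameters; an
  infimum at 0 contradicts \<open>start\<close>.\<close>

lemma unique_zero_by_deformation:
  fixes h A B :: "real \<Rightarrow> complex \<Rightarrow> complex"
  assumes der: "\<And>t z. t \<in> {0..1} \<Longrightarrow> z \<in> cball 0 1 \<Longrightarrow>
      ((\<lambda>x. h (fst x) (snd x)) has_derivative (\<lambda>y. of_real (fst y) * A t z + B t z * snd y)) (at (t, z))"
    and contB: "continuous_on ({0..1} \<times> cball 0 1) (\<lambda>x. B (fst x) (snd x))"
    and nz: "\<And>t z. t \<in> {0..1} \<Longrightarrow> z \<in> cball 0 1 \<Longrightarrow> B t z \<noteq> 0"
    and inward: "\<And>t z. 0 < t \<Longrightarrow> t < 1 \<Longrightarrow> cmod z = 1 \<Longrightarrow> h t z = 0 \<Longrightarrow> Re (cnj z * (A t z / B t z)) < 0"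
    and start: "\<And>z. z \<in> cball 0 1 \<Longrightarrow> h 0 z = 0 \<Longrightarrow> z = 0"
    and z12: "z1 \<in> ball 0 1" "z2 \<in> ball 0 1" "h 1 z1 = 0" "h 1 z2 = 0"
  shows "z1 = z2"
proof (rule ccontr)
  assume "z1 \<noteq> z2"
  have derz: "(h t has_field_derivative B t z) (at z)" if "t \<in> {0..1}" "z \<in> cball 0 1" for t z
  proof -
    have "((\<lambda>z. (t, z)) has_derivative (\<lambda>y. (0, y))) (at z)"
      by (auto intro!: derivative_eq_intros)
    from has_derivative_compose[OF this der[OF that]]
    show ?thesis by (simp add: has_field_derivative_def)
  qed
  have conth: "continuous_on ({0..1} \<times> cball 0 1) (\<lambda>x. h (fst x) (snd x))"
  proof (intro continuous_at_imp_continuous_on ballI)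
    fix x :: "real \<times> complex" assume "x \<in> {0..1} \<times> cball 0 1"
    then show "isCont (\<lambda>x. h (fst x) (snd x)) x"
      using has_derivative_continuous[OF der[of "fst x" "snd x"]] by (simp add: mem_Times_iff)
  qed
  have hol: "continuous_on (cball 0 1) (h t) \<and> h t holomorphic_on ball 0 1" if "t \<in> {0..1}" for t
  proof
    show "continuous_on (cball 0 1) (h t)"
      using derz[OF that] by (meson DERIV_isCont continuous_at_imp_continuous_on)
    show "h t holomorphic_on ball 0 1"
      using derz[OF that] ball_subset_cball by (subst holomorphic_on_open) blast+
  qed
  define S where "S = {t \<in> {0..1}. \<exists>a\<in>cball 0 1. \<exists>b\<in>cball 0 1. a \<noteq> b \<and> h t a = 0 \<and> h t b = 0}"
  have "closed S"
    unfolding closed_sequential_limits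
  proof safe
    fix t l assume t: "\<forall>n. t n \<in> S" and lim: "t \<longlonglongrightarrow> l"
    then obtain a b where ab: "\<And>n. a n \<in> cball 0 1" "\<And>n. b n \<in> cball 0 1" "\<And>n. a n \<noteq> b n"
        "\<And>n. h (t n) (a n) = 0" "\<And>n. h (t n) (b n) = 0"
      unfolding S_def mem_Collect_eq Bex_def by metis
    have t01: "t n \<in> {0..1}" for n using t by (simp add: S_def)
    have l: "l \<in> {0..1}"
      using closed_sequentially[OF closed_real_atLeastAtMost, of t 0 1 l] t01 lim by blast
    have "compact (cball (0::complex) 1 \<times> cball (0::complex) 1)"
      by (intro compact_Times) auto
    then obtain p r where r: "strict_mono r" and p: "p \<in> cball 0 1 \<times> cball 0 1"
        and pl: "((\<lambda>n. (a n, b n)) \<circ> r) \<longlonglongrightarrow> p"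
      using ab(1,2) unfolding compact_def by (blast elim: allE[of _ "\<lambda>n. (a n, b n)"])
    define x y where "x = fst p" and "y = snd p"
    have xy: "x \<in> cball 0 1" "y \<in> cball 0 1" using p by (auto simp: x_def y_def)
    have xl: "(\<lambda>n. a (r n)) \<longlonglongrightarrow> x" and yl: "(\<lambda>n. b (r n)) \<longlonglongrightarrow> y"
      using tendsto_fst[OF pl] tendsto_snd[OF pl] by (simp_all add: x_def y_def o_def)
    have tl: "(\<lambda>n. t (r n)) \<longlonglongrightarrow> l"
      using LIMSEQ_subseq_LIMSEQ[OF lim r] by (simp add: o_def)
    have lim0: "h l c = 0" if "(\<lambda>n. c' n) \<longlonglongrightarrow> c" "c \<in> cball 0 1" "\<And>n. c' n \<in> cball 0 1" "\<And>n. h (t (r n)) (c' n) = 0" for c c'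
    proof -
      have "(\<lambda>n. (t (r n), c' n)) \<longlonglongrightarrow> (l, c)" using tl that(1) by (rule tendsto_Pair)
      then have "(\<lambda>n. h (fst (t (r n), c' n)) (snd (t (r n), c' n))) \<longlonglongrightarrow> h (fst (l, c)) (snd (l, c))"
        by (rule continuous_on_tendsto_compose[OF conth]) (use l that t01 in auto)
      then show ?thesis using that(4) by (simp add: LIMSEQ_const_iff)
    qed
    have hx: "h l x = 0" using xl xy ab by (intro lim0[of "\<lambda>n. a (r n)"]) auto
    have hy: "h l y = 0" using yl xy ab by (intro lim0[of "\<lambda>n. b (r n)"]) auto
    have "x \<noteq> y"
    proof
      assume "x = y"
      obtain d where d: "d > 0" "\<And>t. t \<in> {0..1} \<Longrightarrow> \<bar>t - l\<bar> < d \<Longrightarrow> inj_on (h t) (ball x d \<inter> cball 0 1)"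
        using locally_uniformly_injective[OF derz contB l xy(1) nz[OF l xy(1)]] by metis
      have "\<forall>\<^sub>F n in sequentially. dist (a (r n)) x < d" "\<forall>\<^sub>F n in sequentially. dist (b (r n)) x < d"
        "\<forall>\<^sub>F n in sequentially. dist (t (r n)) l < d"
        using xl yl tl d(1) \<open>x = y\<close> by (auto intro: tendstoD)
      then have "\<forall>\<^sub>F n in sequentially. False"
      proof eventually_elim
        case (elim n)
        have "inj_on (h (t (r n))) (ball x d \<inter> cball 0 1)"
          using d(2)[OF t01] elim by (simp add: dist_real_def)
        from inj_onD[OF this, of "a (r n)" "b (r n)"] show False
          using ab[of "r n"] elim by (simp add: dist_commute)
      qed
      then show False by simp
    qed
    then show "l \<in> S" using l xy hx hy unfolding S_def by blast
  qed
  have "z1 \<in> cball 0 1" "z2 \<in> cball 0 1" using z12 by auto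
  then have "1 \<in> S" using \<open>z1 \<noteq> z2\<close> z12 unfolding S_def by fastforce
  have bdd: "bdd_below S" by (auto simp: S_def)
  define t0 where "t0 = Inf S"
  have t0S: "t0 \<in> S" unfolding t0_def using \<open>closed S\<close> bdd \<open>1 \<in> S\<close> by (intro closed_contains_Inf) auto
  then have t01: "t0 \<in> {0..1}" by (simp add: S_def)
  have "t0 \<noteq> 0"
  proof
    assume "t0 = 0"
    then obtain a b where "a \<in> cball 0 1" "b \<in> cball 0 1" "a \<noteq> b" "h 0 a = 0" "h 0 b = 0"
      using t0S unfolding S_def by blast
    then show False using start[of a] start[of b] by blast
  qed
  then have "t0 > 0" using t01 by simp
  \<comment> \<open>The inward condition is available only for \<open>t < 1\<close>. At
    \<open>t0 = 1\<close> the zeros \<open>z1\<close> and \<open>z2\<close> are taken, which lie in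
    the open disk.\<close>
  obtain a b where ab: "a \<in> cball 0 1" "b \<in> cball 0 1" "a \<noteq> b" "h t0 a = 0" "h t0 b = 0"
    and bd: "t0 = 1 \<Longrightarrow> cmod a \<noteq> 1 \<and> cmod b \<noteq> 1"
  proof (cases "t0 = 1")
    case True
    then show thesis using that[of z1 z2] z12 \<open>z1 \<noteq> z2\<close> by simp
  next
    case False
    then show thesis using t0S that unfolding S_def by blast
  qed
  define e where "e = dist a b / 2"
  have "e > 0" using ab by (simp add: e_def)
  have move: "\<forall>\<^sub>F t in at_left t0. \<exists>z\<in>cball 0 1. dist z c < e \<and> h t z = 0"
    if "c \<in> cball 0 1" "h t0 c = 0" "t0 = 1 \<Longrightarrow> cmod c \<noteq> 1" for c
  proof (rule simple_zero_moves_inward[OF der[OF t01 that(1)] hol \<open>t0 > 0\<close> that(2) nz[OF t01 that(1)]])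
    show "Re (cnj c * (A t0 c / B t0 c)) < 0" if "cmod c = 1"
      using inward[of t0 c] that \<open>t0 > 0\<close> t01 \<open>h t0 c = 0\<close> \<open>t0 = 1 \<Longrightarrow> cmod c \<noteq> 1\<close> by fastforce
  qed (use that t01 \<open>e > 0\<close> in auto)
  have "\<forall>\<^sub>F t in at_left t0. t \<in> {0<..<t0}"
    using \<open>t0 > 0\<close> by (rule eventually_at_left_real)
  moreover have "\<forall>\<^sub>F t in at_left t0. \<exists>z\<in>cball 0 1. dist z a < e \<and> h t z = 0"
    "\<forall>\<^sub>F t in at_left t0. \<exists>z\<in>cball 0 1. dist z b < e \<and> h t z = 0"
    using ab bd by (auto intro!: move)
  ultimately have "\<forall>\<^sub>F t in at_left t0. t \<in> S \<and> t < t0"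
  proof eventually_elim
    case (elim t)
    then obtain x y where xy: "x \<in> cball 0 1" "dist x a < e" "h t x = 0" "y \<in> cball 0 1" "dist y b < e" "h t y = 0"
      by blast
    have "x \<noteq> y" using xy dist_triangle_half_r[of x a "dist a b" b] by (auto simp: e_def dist_commute)
    moreover have "t \<in> {0..1}" "t < t0" using elim t01 by auto
    ultimately show ?case using xy unfolding S_def by blast
  qed
  from eventually_happens'[OF _ this] obtain t where "t \<in> S" "t < t0"
    by auto
  then show False using cInf_lower[OF _ bdd, of t] by (simp add: t0_def)
qed

section \<open>Functions with positive real part\<close>

lemma has_real_derivative_cmod_squared:
  assumes "(g has_vector_derivative g') (at (s::real))"
  shows "((\<lambda>s. (cmod (g s))\<^sup>2) has_real_derivative 2 * Re (cnj (g s) * g')) (at s)"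
proof -
  have "((\<lambda>s. (Re (g s))\<^sup>2 + (Im (g s))\<^sup>2) has_real_derivative 2 * Re (cnj (g s) * g')) (at s)"
    by (rule derivative_eq_intros has_field_derivative_Re[OF assms] has_field_derivative_Im[OF assms] refl)+
      (simp add: algebra_simps)
  then show ?thesis by (simp add: cmod_power2)
qed

text \<open>A boundary form of Jack's lemma: a bound \<open>\<bar>w(z0 \<zeta>)\<bar> \<le> \<bar>\<zeta>\<bar>\<close> that is attained at \<open>\<zeta> = 1\<close> can be
  differentiated in every inward direction \<open>u\<close>.\<close>
lemma boundary_Schwarz_direction:
  fixes w :: "complex \<Rightarrow> complex"
  assumes der: "(w has_field_derivative w') (at z0)"
    and bound: "\<And>\<zeta>. cmod \<zeta> < 1 \<Longrightarrow> cmod (w (z0 * \<zeta>)) \<le> cmod \<zeta>"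
    and one: "cmod (w z0) = 1" and u: "Re u < 0"
  shows "Re ((1 - z0 * w' / w z0) * u) \<ge> 0"
proof (rule ccontr)
  assume neg: "\<not> ?thesis"
  have "w z0 \<noteq> 0" using one by auto
  define g where "g = (\<lambda>s::real. w (z0 * (1 + of_real s * u)))"
  have 1: "((\<lambda>s::real. 1 + of_real s * u) has_vector_derivative u) (at 0)"
    by (auto intro!: derivative_eq_intros)
  have 2: "((\<lambda>s::real. z0 * (1 + of_real s * u)) has_vector_derivative z0 * u) (at 0)"
    by (auto intro!: derivative_eq_intros)
  have "(w has_field_derivative w') (at (z0 * (1 + of_real 0 * u)))" using der by simp
  from field_vector_diff_chain_at[OF 2 this]
  have g: "(g has_vector_derivative z0 * u * w') (at 0)" by (simp add: g_def o_def)
  have g0: "g 0 = w z0" by (simp add: g_def)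
  \<comment> \<open>\<open>D\<close> is the derivative at 0 of the squared bound minus the squared
    modulus of \<open>g\<close>. Both are 1 at 0, so a negative \<open>D\<close> would violate the
    bound for small positive \<open>s\<close>.\<close>
  define D where "D = 2 * Re (cnj (1 + of_real 0 * u) * u) - 2 * Re (cnj (g 0) * (z0 * u * w'))"
  have "((\<lambda>s. (cmod (1 + of_real s * u))\<^sup>2 - (cmod (g s))\<^sup>2) has_real_derivative D) (at 0)"
    unfolding D_def by (intro derivative_intros has_real_derivative_cmod_squared 1 g)
  moreover have "D < 0"
  proof -
    have "cnj (w z0) * w z0 = 1"
      using one by (metis complex_norm_square mult.commute of_real_1 one_power2)
    then have "cnj (w z0) = 1 / w z0" using \<open>w z0 \<noteq> 0\<close> by (simp add: field_simps)
    then have "D = 2 * Re ((1 - z0 * w' / w z0) * u)"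
      unfolding D_def g0 by (simp add: algebra_simps del: times_complex.sel)
    then show ?thesis using neg by simp
  qed
  ultimately obtain d where d: "d > 0" and dec: "\<And>h. 0 < h \<Longrightarrow> h < d \<Longrightarrow>
      (cmod (1 + of_real h * u))\<^sup>2 - (cmod (g h))\<^sup>2 < (cmod (1 + of_real 0 * u))\<^sup>2 - (cmod (g 0))\<^sup>2"
    using DERIV_neg_dec_right[of "\<lambda>s. (cmod (1 + of_real s * u))\<^sup>2 - (cmod (g s))\<^sup>2" D 0] by auto
  have "((\<lambda>s. (cmod (1 + of_real s * u))\<^sup>2) has_real_derivative 2 * Re (cnj (1 + of_real 0 * u) * u)) (at 0)"
    by (intro has_real_derivative_cmod_squared 1)
  then obtain d' where d': "d' > 0" and lt: "\<And>h. 0 < h \<Longrightarrow> h < d' \<Longrightarrow>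
      (cmod (1 + of_real h * u))\<^sup>2 < (cmod (1 + of_real 0 * u))\<^sup>2"
    using DERIV_neg_dec_right[of "\<lambda>s. (cmod (1 + of_real s * u))\<^sup>2" "2 * Re (cnj (1 + of_real 0 * u) * u)" 0] u by auto
  define h where "h = min d d' / 2"
  have h: "0 < h" "h < d" "h < d'" using d d' by (auto simp: h_def)
  have "(cmod (1 + of_real h * u))\<^sup>2 < 1\<^sup>2" using lt[OF h(1,3)] by simp
  then have "cmod (1 + of_real h * u) < 1" by (rule power2_less_imp_less) simp
  then have "cmod (g h) \<le> cmod (1 + of_real h * u)" unfolding g_def by (rule bound)
  then have "(cmod (g h))\<^sup>2 \<le> (cmod (1 + of_real h * u))\<^sup>2" by (rule power_mono) simp
  moreover have "(cmod (g 0))\<^sup>2 = 1" "(cmod (1 + of_real 0 * u))\<^sup>2 = 1" by (simp_all add: g0 one)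
  ultimately show False using dec[OF h(1,2)] by linarith
qed

lemma Re_div_one_minus_unimodular:
  assumes "cmod w = 1" "w \<noteq> 1"
  shows "Re (w / (1 - w)) = - (1 / 2)"
proof -
  have n: "(Re w)\<^sup>2 + (Im w)\<^sup>2 = 1" using assms(1) by (metis cmod_power2 one_power2)
  have "Re w \<noteq> 1"
    using n assms(2) by (auto simp: complex_eq_iff)
  have "(1 - Re w)\<^sup>2 + (Im w)\<^sup>2 = 2 * (1 - Re w)" "Re w * (1 - Re w) - (Im w)\<^sup>2 = Re w - 1"
    using n by (auto simp: power2_eq_square algebra_simps)
  then show ?thesis using \<open>Re w \<noteq> 1\<close>
    by (simp add: Re_divide power2_eq_square[symmetric] divide_simps)
qed

text \<open>With \<open>w = 1 - exp (- L / 2)\<close> and \<open>q = z * w' / w\<close> one has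
  \<open>z * deriv L z = 2 * q * (w / (1 - w))\<close>. At a point of least modulus where
  \<open>cmod w\<close> reaches 1, the Schwarz lemma makes \<open>q\<close> real with
  \<open>q \<ge> 1\<close>, while \<open>w / (1 - w)\<close> has real part \<open>- 1 / 2\<close>.
  Hence \<open>Re (1 + z * deriv L z) = 1 - q \<le> 0\<close> there.\<close>

lemma Marx_Strohhaecker:
  assumes hol: "L holomorphic_on ball 0 R" and L0: "L 0 = 0"
    and pos: "\<And>z. z \<in> ball 0 R \<Longrightarrow> Re (1 + z * deriv L z) > 0"
    and z: "z \<in> ball 0 R"
  shows "cmod (1 - exp (- L z / 2)) < 1"
proof (rule ccontr)
  assume contra: "\<not> ?thesis"
  define w where "w = (\<lambda>z. 1 - exp (- L z / 2))"
  have holw: "w holomorphic_on ball 0 R" unfolding w_def by (intro holomorphic_intros hol) auto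
  have sub: "cball 0 (cmod z) \<subseteq> ball 0 R" using z by auto
  have contw: "continuous_on (cball 0 (cmod z)) w"
    using holomorphic_on_imp_continuous_on holomorphic_on_subset[OF holw sub] by blast
  define C where "C = {x \<in> cball 0 (cmod z). 1 \<le> cmod (w x)}"
  have "closed C" unfolding C_def
    by (rule continuous_closed_preimage[of _ "\<lambda>x. cmod (w x)" "{1..}", unfolded vimage_def Int_def, simplified])
       (auto intro!: continuous_intros contw)
  moreover have "C \<subseteq> cball 0 (cmod z)" by (auto simp: C_def)
  ultimately have "compact C"
    by (metis compact_cball compact_Int_closed inf.absorb2 inf.commute)
  have "z \<in> C" using contra by (simp add: C_def w_def)
  then obtain z0 where z0: "z0 \<in> C" and least: "\<And>x. x \<in> C \<Longrightarrow> cmod z0 \<le> cmod x"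
    using continuous_attains_inf[of C cmod] \<open>compact C\<close> continuous_on_norm_id by blast
  have z0R: "z0 \<in> ball 0 R" and z0z: "cmod z0 \<le> cmod z" using z0 z by (auto simp: C_def)
  have w0: "w 0 = 0" by (simp add: w_def L0)
  then have "z0 \<noteq> 0" using z0 by (auto simp: C_def)
  have lt: "cmod (w x) < 1" if "cmod x < cmod z0" for x
    using least[of x] that z0z by (force simp: C_def)
  have bound: "cmod (w (z0 * \<zeta>)) \<le> cmod \<zeta>" if "cmod \<zeta> < 1" for \<zeta>
  proof (rule Schwarz_Lemma(1)[where f = "\<lambda>\<zeta>. w (z0 * \<zeta>)"])
    have *: "cmod (z0 * x) < cmod z0" if "cmod x < 1" for x
      using that \<open>z0 \<noteq> 0\<close> by (simp add: norm_mult)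
    show "(\<lambda>\<zeta>. w (z0 * \<zeta>)) holomorphic_on ball 0 1"
      using * z0R by (intro holomorphic_on_compose_gen[OF _ holw, unfolded o_def] holomorphic_intros) force
    show "cmod (w (z0 * x)) < 1" if "cmod x < 1" for x
      using * that lt by blast
  qed (use that w0 in auto)
  have one: "cmod (w z0) = 1"
  proof (rule antisym)
    have "isCont w z0"
      using holomorphic_on_imp_continuous_on[OF holw] z0R by (simp add: continuous_on_eq_continuous_at)
    moreover have "((\<lambda>s. z0 * of_real s) \<longlongrightarrow> z0 * of_real 1) (at_left (1::real))"
      by (intro tendsto_intros)
    ultimately have "((\<lambda>s. cmod (w (z0 * of_real s))) \<longlongrightarrow> cmod (w (z0 * of_real 1))) (at_left (1::real))"
      by (intro tendsto_norm isCont_tendsto_compose[of "z0 * of_real 1" w]) simp_all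
    moreover have "\<forall>\<^sub>F s in at_left (1::real). cmod (w (z0 * of_real s)) \<le> 1"
      using eventually_at_left_real[OF zero_less_one]
    proof eventually_elim
      case (elim s)
      then show ?case using bound[of "of_real s"] by simp
    qed
    ultimately show "cmod (w z0) \<le> 1"
      using tendsto_upperbound[of "\<lambda>s. cmod (w (z0 * of_real s))"] by force
    show "1 \<le> cmod (w z0)" using z0 by (simp add: C_def)
  qed
  define w' where "w' = exp (- L z0 / 2) * deriv L z0 / 2"
  have der: "(w has_field_derivative w') (at z0)"
    unfolding w_def w'_def using holomorphic_derivI[OF hol open_ball z0R]
    by (auto intro!: derivative_eq_intros)
  define q where "q = z0 * w' / w z0"
  have dir: "Re ((1 - q) * u) \<ge> 0" if "Re u < 0" for u
    unfolding q_def using boundary_Schwarz_direction[OF der bound one that] by simp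
  have "Im (1 - q) = 0"
  proof (rule ccontr)
    assume "Im (1 - q) \<noteq> 0"
    \<comment> \<open>The imaginary part of this direction is chosen so that
      \<open>Re ((1 - q) * u) = - 1\<close>.\<close>
    then show False using dir[of "Complex (-1) ((1 - Re (1 - q)) / Im (1 - q))"] by (simp del: minus_complex.sel)
  qed
  then have Imq: "Im q = 0" by simp
  have Req: "Re q \<ge> 1" using dir[of "-1"] by simp
  have "w z0 \<noteq> 1" by (simp add: w_def)
  have "z0 * deriv L z0 = 2 * q * (w z0 / (1 - w z0))"
  proof -
    have "w z0 \<noteq> 0" using one by auto
    moreover have "1 - w z0 = exp (- L z0 / 2)" by (simp add: w_def)
    ultimately show ?thesis by (simp add: q_def w'_def)
  qed
  also have "Re \<dots> = 2 * Re q * Re (w z0 / (1 - w z0))"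
    using Imq by (simp del: times_divide_eq_right)
  also have "\<dots> = - Re q" using Re_div_one_minus_unimodular[OF one \<open>w z0 \<noteq> 1\<close>] by simp
  finally have "Re (1 + z0 * deriv L z0) \<le> 0" using Req by simp
  with pos[OF z0R] show False by simp
qed

text \<open>Otherwise \<open>\<bar>Im L\<bar>\<close> equals \<open>pi\<close> somewhere on the
  segment from 0 to \<open>z\<close>. There \<open>exp (- L / 2)\<close> is purely imaginary, so
  \<open>1 - exp (- L / 2)\<close> has real part 1, against
  \<open>Marx_Strohhaecker\<close>.\<close>

lemma abs_Im_less_pi:
  assumes hol: "L holomorphic_on ball 0 R" and L0: "L 0 = 0"
    and pos: "\<And>z. z \<in> ball 0 R \<Longrightarrow> Re (1 + z * deriv L z) > 0"
    and z: "z \<in> ball 0 R"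
  shows "\<bar>Im (L z)\<bar> < pi"
proof (rule ccontr)
  assume contra: "\<not> ?thesis"
  have sub: "of_real s * z \<in> ball 0 R" if "0 \<le> s" "s \<le> 1" for s
  proof -
    have "s * cmod z \<le> 1 * cmod z" using that by (intro mult_right_mono) auto
    then show ?thesis using z that by (simp add: norm_mult)
  qed
  have "continuous_on {0..1} (\<lambda>s. L (of_real s * z))"
    using sub by (intro continuous_on_compose2[OF holomorphic_on_imp_continuous_on[OF hol]] continuous_intros) auto
  then have "continuous_on {0..1} (\<lambda>s. \<bar>Im (L (of_real s * z))\<bar>)"
    by (intro continuous_intros)
  then obtain s where s: "0 \<le> s" "s \<le> 1" "\<bar>Im (L (of_real s * z))\<bar> = pi"
    using IVT'[of "\<lambda>s. \<bar>Im (L (of_real s * z))\<bar>" 0 pi 1] contra L0 by auto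
  let ?x = "of_real s * z"
  have "cos (Im (L ?x) / 2) = 0"
    using s(3) by (auto simp: abs_if split: if_splits)
      (metis cos_minus cos_pi_half minus_divide_left)
  then have "Re (exp (- L ?x / 2)) = 0" by (simp add: Re_exp)
  then have "Re (1 - exp (- L ?x / 2)) = 1" by simp
  then have "cmod (1 - exp (- L ?x / 2)) \<ge> 1" by (metis complex_Re_le_cmod)
  with Marx_Strohhaecker[OF hol L0 pos sub[OF s(1,2)]] show False by simp
qed

lemma Re_exp_scaled_pos:
  assumes hol: "L holomorphic_on ball 0 R" and L0: "L 0 = 0"
    and pos: "\<And>z. z \<in> ball 0 R \<Longrightarrow> Re (1 + z * deriv L z) > 0"
    and z: "z \<in> ball 0 R" and x: "\<bar>x\<bar> \<le> 1 / 2"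
  shows "Re (exp (of_real x * L z)) > 0"
proof -
  have "\<bar>x * Im (L z)\<bar> \<le> 1 / 2 * \<bar>Im (L z)\<bar>"
    unfolding abs_mult using x by (intro mult_right_mono) auto
  also have "\<dots> < pi / 2" using abs_Im_less_pi[OF hol L0 pos z] by simp
  finally show ?thesis by (simp add: Re_exp cos_gt_zero_pi abs_less_iff)
qed

text \<open>Positivity means \<open>Re \<zeta> > - 1 / 2\<close>, the half-plane that
  \<open>\<zeta> / (1 + \<zeta>)\<close> maps to the unit disk with 0 fixed; the Schwarz lemma
  applies to the composition.\<close>

lemma Schwarz_Caratheodory:
  assumes hol: "L holomorphic_on ball 0 1"
    and pos: "\<And>z. z \<in> ball 0 1 \<Longrightarrow> Re (1 + z * deriv L z) > 0"
    and z: "z \<in> ball 0 1"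
  defines "\<zeta> \<equiv> z * deriv L z / 2"
  shows "cmod \<zeta> \<le> cmod z * cmod (1 + \<zeta>)"
proof -
  define p where "p = (\<lambda>z. z * deriv L z / 2)"
  define w where "w = (\<lambda>z. p z / (1 + p z))"
  have rp: "Re (p x) > - (1/2)" if "cmod x < 1" for x
    using pos[of x] that by (simp add: p_def)
  have nz: "1 + p x \<noteq> 0" if "cmod x < 1" for x
    using rp[OF that] by (auto simp: complex_eq_iff)
  have "cmod (w z) \<le> cmod z"
  proof (rule Schwarz_Lemma(1))
    show "w holomorphic_on ball 0 1" unfolding w_def
      using nz unfolding p_def by (intro holomorphic_intros hol) auto
    show "cmod (w x) < 1" if "cmod x < 1" for x
    proof -
      have "(cmod (p x))\<^sup>2 < (cmod (1 + p x))\<^sup>2"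
        using rp[OF that] unfolding cmod_power2 by (simp add: power2_eq_square algebra_simps)
      then have "cmod (p x) < cmod (1 + p x)" by (rule power2_less_imp_less) simp
      then show ?thesis using nz[OF that] by (simp add: w_def norm_divide)
    qed
  qed (use z in \<open>auto simp: w_def p_def\<close>)
  then have "cmod (p z) \<le> cmod z * cmod (1 + p z)"
    using nz[of z] z by (simp add: w_def norm_divide field_simps)
  then show ?thesis by (simp add: \<zeta>_def p_def)
qed

text \<open>For \<open>t < 1\<close> the hypothesis describes the Apollonius disk with centre
  \<open>t\<^sup>2 / (1 - t\<^sup>2)\<close> and radius \<open>t / (1 - t\<^sup>2)\<close>. The
  conclusion is its equation with denominators cleared.\<close>

lemma Apollonius_bound:
  fixes \<zeta> :: complex
  assumes t: "0 \<le> t" "t \<le> 1" and le: "cmod \<zeta> \<le> t * cmod (1 + \<zeta>)"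
  shows "cmod (of_real (t\<^sup>2) - of_real (1 - t\<^sup>2) * \<zeta>) \<le> t"
proof -
  have "(cmod \<zeta>)\<^sup>2 \<le> t\<^sup>2 * (cmod (1 + \<zeta>))\<^sup>2"
    using power_mono[OF le, of 2] by (simp add: power_mult_distrib)
  then have "(1 - t\<^sup>2) * (t\<^sup>2 * (cmod (1 + \<zeta>))\<^sup>2 - (cmod \<zeta>)\<^sup>2) \<ge> 0"
    using t by (intro mult_nonneg_nonneg) (auto simp: power_le_one)
  moreover have "(cmod (of_real (t\<^sup>2) - of_real (1 - t\<^sup>2) * \<zeta>))\<^sup>2
      = t\<^sup>2 - (1 - t\<^sup>2) * (t\<^sup>2 * (cmod (1 + \<zeta>))\<^sup>2 - (cmod \<zeta>)\<^sup>2)"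
    unfolding cmod_power2 by (simp add: power2_eq_square algebra_simps)
  ultimately have "(cmod (of_real (t\<^sup>2) - of_real (1 - t\<^sup>2) * \<zeta>))\<^sup>2 \<le> t\<^sup>2" by simp
  then show ?thesis using t(1) by (rule power2_le_imp_le)
qed

section \<open>Univalence criteria\<close>

lemma has_derivative_compose_scale:
  fixes G :: "complex \<Rightarrow> complex"
  assumes "(G has_field_derivative G') (at (of_real t * z))"
  shows "((\<lambda>x. G (of_real (fst x) * snd x)) has_derivative
      (\<lambda>y. G' * (of_real (fst y) * z + of_real t * snd y))) (at (t, z))"
proof -
  have "((\<lambda>x. of_real (fst x) * snd x :: complex) has_derivative
      (\<lambda>y. of_real (fst y) * z + of_real t * snd y)) (at (t, z))"
    by (auto intro!: derivative_eq_intros simp: algebra_simps)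
  from has_derivative_compose[OF this, of G "(*) G'"] assms
  show ?thesis by (simp add: has_field_derivative_def)
qed

text \<open>With \<open>t = exp (- s)\<close>, the relation between \<open>A\<close> and
  \<open>B\<close> is the Loewner equation with Herglotz function \<open>P\<close>, to be checked at
  boundary zeros of a chain. On the circle it gives
  \<open>cnj z * (A / B) = - P / t\<close>.\<close>

lemma inward_velocity:
  fixes A B P z :: complex
  assumes "t > 0" "of_real t * A = - (z * B * P)" "B \<noteq> 0" "Re P > 0" "cmod z = 1"
  shows "Re (cnj z * (A / B)) < 0"
proof -
  have "cnj z * z = 1"
    using assms(5) by (metis complex_norm_square mult.commute of_real_1 one_power2)
  have "A = - (z * B * P) / of_real t"
    using assms(1,2) by (simp add: field_simps)
  then have "cnj z * (A / B) = - ((cnj z * z) * P) / of_real t"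
    using assms(3) by (simp add: field_simps)
  then show ?thesis using assms(1,4) \<open>cnj z * z = 1\<close> by (simp add: divide_less_0_iff)
qed

lemma Re_one_plus_over_one_minus_pos:
  assumes "cmod Q < 1"
  shows "Re ((1 + Q) / (1 - Q)) > 0"
proof -
  have "(Re Q)\<^sup>2 + (Im Q)\<^sup>2 < 1"
    using assms by (metis abs_norm_cancel abs_square_less_1 cmod_power2)
  then have "(1 + Re Q) * (1 - Re Q) - Im Q * Im Q > 0"
    by (simp add: power2_eq_square algebra_simps)
  moreover have "Q \<noteq> 1" using assms by auto
  then have "(1 - Re Q)\<^sup>2 + (Im Q)\<^sup>2 > 0"
    by (auto simp: complex_eq_iff sum_power2_gt_zero_iff)
  ultimately show ?thesis by (simp add: Re_divide)
qed

text \<open>For \<open>t = e\<^bsup>-s\<^esup>\<close>, the function \<open>h\<close> below is a rescaling of the Loewner chain behind the univalence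
  criterion of Ahlfors and Becker with constant \<open>-2\<delta>\<close>; it degenerates at \<open>\<delta> = 1/2\<close>.\<close>
lemma univalent_Ahlfors_chain:
  assumes "R > 1" and hol: "L holomorphic_on ball 0 R"
    and pos: "\<And>z. z \<in> ball 0 R \<Longrightarrow> Re (1 + z * deriv L z) > 0"
    and F: "\<And>z. z \<in> ball 0 R \<Longrightarrow> (F has_field_derivative exp (\<delta> * L z)) (at z)"
    and \<delta>: "cmod \<delta> \<le> 1 / 2" "\<delta> \<noteq> 1 / 2"
  shows "inj_on F (ball 0 1)"
proof (rule inj_onI)
  fix z1 z2 assume z12: "z1 \<in> ball 0 1" "z2 \<in> ball 0 1" "F z1 = F z2"
  define v where "v = F z2"
  define E where "E = (\<lambda>w. exp (\<delta> * L w))"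
  \<comment> \<open>\<open>Q\<close> is read off from the \<open>z\<close>-derivative of
    \<open>h\<close>, which is \<open>E * (1 - Q)\<close>. At zeros of \<open>h\<close> the
    \<open>t\<close>-derivative satisfies \<open>t * A = - z * E * (1 + Q)\<close>, so
    \<open>(1 + Q) / (1 - Q)\<close> is the Herglotz function.\<close>
  define Q where "Q = (\<lambda>(t::real) z. \<delta> * (2 * (of_real t)\<^sup>2 - (1 - (of_real t)\<^sup>2) *
      (of_real t * z * deriv L (of_real t * z))))"
  define h where "h = (\<lambda>(t::real) z. (1 - 2 * \<delta>) * of_real t * (F (of_real t * z) - v)
      + (1 - (of_real t)\<^sup>2) * z * E (of_real t * z))"
  define A where "A = (\<lambda>(t::real) z. (1 - 2 * \<delta>) * (F (of_real t * z) - v)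
      + ((1 - 2 * \<delta>) * of_real t * z - 2 * of_real t * z
         + (1 - (of_real t)\<^sup>2) * z * \<delta> * deriv L (of_real t * z) * z) * E (of_real t * z))"
  define B where "B = (\<lambda>(t::real) z. E (of_real t * z) * (1 - Q t z))"
  have inR: "of_real t * z \<in> ball 0 R" if "t \<in> {0..1}" "z \<in> cball 0 1" for t :: real and z :: complex
  proof -
    have "t * cmod z \<le> 1" using that by (intro mult_le_one) auto
    then show ?thesis using that \<open>R > 1\<close> by (simp add: norm_mult)
  qed
  have derE: "(E has_field_derivative \<delta> * deriv L w * E w) (at w)" if "w \<in> ball 0 R" for w
    unfolding E_def using holomorphic_derivI[OF hol open_ball that]
    by (auto intro!: derivative_eq_intros)
  have derF: "(F has_field_derivative E w) (at w)" if "w \<in> ball 0 R" for w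
    unfolding E_def using F[OF that] .
  \<comment> \<open>\<open>Q\<close> is \<open>2 * \<delta>\<close> times the expression in
    \<open>Apollonius_bound\<close>, hence at most \<open>t\<close> in modulus; here
    \<open>cmod \<delta> \<le> 1 / 2\<close> enters.\<close>
  have Q1: "cmod (Q t z) < 1" if t: "0 \<le> t" "t < 1" and z: "z \<in> cball 0 1" for t z
  proof -
    define \<zeta> where "\<zeta> = of_real t * z * deriv L (of_real t * z) / 2"
    have tz: "cmod (of_real t * z) \<le> t"
      using t z by (simp add: norm_mult mult_left_le)
    have "cmod \<zeta> \<le> cmod (of_real t * z) * cmod (1 + \<zeta>)"
      unfolding \<zeta>_def using \<open>R > 1\<close> tz t
      by (intro Schwarz_Caratheodory holomorphic_on_subset[OF hol] pos) auto
    also have "\<dots> \<le> t * cmod (1 + \<zeta>)" using tz by (intro mult_right_mono) auto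
    finally have "cmod (of_real (t\<^sup>2) - of_real (1 - t\<^sup>2) * \<zeta>) \<le> t"
      using t by (intro Apollonius_bound) auto
    moreover have "Q t z = 2 * \<delta> * (of_real (t\<^sup>2) - of_real (1 - t\<^sup>2) * \<zeta>)"
    proof -
      have "of_real t * z * deriv L (of_real t * z) = 2 * \<zeta>" by (simp add: \<zeta>_def)
      then show ?thesis unfolding Q_def by (simp only:) (simp add: algebra_simps)
    qed
    then have "cmod (Q t z) = 2 * cmod \<delta> * cmod (of_real (t\<^sup>2) - of_real (1 - t\<^sup>2) * \<zeta>)"
      by (simp add: norm_mult)
    ultimately have "cmod (Q t z) \<le> 1 * t"
      using \<delta>(1) by (simp only:) (intro mult_mono, auto)
    then show ?thesis using t by simp
  qed
  show "z1 = z2"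
  proof (rule unique_zero_by_deformation[of h A B])
    fix t :: real and z :: complex assume tz: "t \<in> {0..1}" "z \<in> cball 0 1"
    show "((\<lambda>x. h (fst x) (snd x)) has_derivative (\<lambda>y. of_real (fst y) * A t z + B t z * snd y)) (at (t, z))"
      unfolding h_def
      by (rule derivative_eq_intros refl has_derivative_compose_scale[OF derF[OF inR[OF tz]]]
           has_derivative_compose_scale[OF derE[OF inR[OF tz]]])+
         (simp add: A_def B_def Q_def fun_eq_iff algebra_simps power2_eq_square)
    show "B t z \<noteq> 0"
    \<comment> \<open>At \<open>t = 1\<close> the function \<open>Q\<close> is the constant
      \<open>2 * \<delta>\<close>, so \<open>B\<close> vanishes only for the excluded value
      \<open>\<delta> = 1 / 2\<close>.\<close>
    proof (cases "t = 1")
      case True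
      then show ?thesis using \<delta>(2) by (auto simp: B_def Q_def E_def)
    next
      case False
      then show ?thesis using Q1[of t z] tz by (auto simp: B_def E_def)
    qed
  next
    have c: "continuous_on ({0..1} \<times> cball 0 1) (\<lambda>x. G (of_real (fst x) * snd x))"
      if "G holomorphic_on ball 0 R" for G
      using inR by (intro continuous_on_compose2[OF holomorphic_on_imp_continuous_on[OF that]] continuous_intros) auto
    show "continuous_on ({0..1} \<times> cball 0 1) (\<lambda>x. B (fst x) (snd x))"
      unfolding B_def Q_def E_def
      by (intro continuous_intros c hol holomorphic_intros) auto
  next
    fix t :: real and z :: complex assume t: "0 < t" "t < 1" and z: "cmod z = 1" and h0: "h t z = 0"
    let ?w = "of_real t * z"
    have q: "cmod (Q t z) < 1" using Q1 t z by simp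
    then have q1: "1 - Q t z \<noteq> 0" by auto
    \<comment> \<open>The equation \<open>h t z = 0\<close> expresses the term with \<open>F\<close>
      and \<open>v\<close> through \<open>E\<close>, which eliminates it from
      \<open>A\<close>.\<close>
    have "(1 - 2 * \<delta>) * of_real t * (F ?w - v) = - ((1 - (of_real t)\<^sup>2) * z * E ?w)"
      using h0 unfolding h_def by (simp add: add_eq_0_iff2)
    moreover have "of_real t * A t z = (1 - 2 * \<delta>) * of_real t * (F ?w - v)
      + of_real t * ((1 - 2 * \<delta>) * of_real t * z - 2 * of_real t * z
         + (1 - (of_real t)\<^sup>2) * z * \<delta> * deriv L ?w * z) * E ?w"
      unfolding A_def by (simp add: algebra_simps)
    ultimately have "of_real t * A t z = - ((1 - (of_real t)\<^sup>2) * z * E ?w)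
      + of_real t * ((1 - 2 * \<delta>) * of_real t * z - 2 * of_real t * z
         + (1 - (of_real t)\<^sup>2) * z * \<delta> * deriv L ?w * z) * E ?w"
      by simp
    also have "\<dots> = - (z * E ?w * (1 + Q t z))"
      unfolding Q_def by (simp add: algebra_simps power2_eq_square)
    also have "\<dots> = - (z * B t z * ((1 + Q t z) / (1 - Q t z)))"
      using q1 by (simp add: B_def)
    finally show "Re (cnj z * (A t z / B t z)) < 0"
      using Re_one_plus_over_one_minus_pos[OF q] t(1) z q1
      by (intro inward_velocity) (auto simp: B_def E_def)
  next
    show "z = 0" if "h 0 z = 0" for z using that by (simp add: h_def E_def)
  qed (use z12 in \<open>auto simp: h_def v_def\<close>)
qed

text \<open>Here \<open>F'/K'\<close> with \<open>K' = e\<^sup>L\<close> has positive real part, and \<open>h\<close> is a rescaling of Kaplan's chain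
  \<open>F + (e\<^sup>s - 1) z K'\<close>, with \<open>t = e\<^bsup>-s\<^esup>\<close>.\<close>
lemma univalent_close_to_convex_chain:
  assumes "R > 1" and hol: "L holomorphic_on ball 0 R" and L0: "L 0 = 0"
    and pos: "\<And>z. z \<in> ball 0 R \<Longrightarrow> Re (1 + z * deriv L z) > 0"
    and F: "\<And>z. z \<in> ball 0 R \<Longrightarrow> (F has_field_derivative exp (of_real x * L z)) (at z)"
    and x: "1 / 2 \<le> x" "x \<le> 3 / 2"
  shows "inj_on F (ball 0 1)"
proof (rule inj_onI)
  fix z1 z2 assume z12: "z1 \<in> ball 0 1" "z2 \<in> ball 0 1" "F z1 = F z2"
  define v where "v = F z2"
  \<comment> \<open>\<open>P\<close> is the \<open>z\<close>-derivative of \<open>h\<close> divided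
    by \<open>exp L\<close>. It runs from \<open>1 + z * deriv L z\<close> at \<open>t = 0\<close>
    to \<open>exp ((x - 1) * L)\<close> at \<open>t = 1\<close>; the latter has positive real part
    because \<open>\<bar>x - 1\<bar> \<le> 1 / 2\<close> and
    \<open>\<bar>Im L\<bar> < pi\<close>.\<close>
  define P where "P = (\<lambda>(t::real) z. of_real t * exp (of_real (x - 1) * L z) + of_real (1 - t) * (1 + z * deriv L z))"
  define h where "h = (\<lambda>(t::real) z. of_real t * (F z - v) + (1 - of_real t) * z * exp (L z))"
  define A where "A = (\<lambda>(t::real) z. F z - v - z * exp (L z))"
  define B where "B = (\<lambda>(t::real) z. exp (L z) * P t z)"
  have inR: "z \<in> ball 0 R" if "z \<in> cball 0 1" for z :: complex
    using that \<open>R > 1\<close> by simp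
  have split: "exp (of_real x * L z) = exp (L z) * exp (of_real (x - 1) * L z)" for z
    by (simp add: exp_add[symmetric] algebra_simps)
  have Ppos: "Re (P t z) > 0" if "t \<in> {0..1}" "z \<in> cball 0 1" for t z
  proof -
    have "Re (exp (of_real (x - 1) * L z)) > 0"
      by (intro Re_exp_scaled_pos[OF hol L0 pos inR[OF that(2)]]) (unfold abs_le_iff, use x in auto)
    then have "Re (P t z) > 0" if "t \<noteq> 0" "t \<noteq> 1"
    proof -
      have "t * Re (exp (of_real (x - 1) * L z)) + (1 - t) * Re (1 + z * deriv L z) > 0"
        using that \<open>t \<in> {0..1}\<close> pos[OF inR[OF \<open>z \<in> cball 0 1\<close>]] \<open>Re (exp (of_real (x - 1) * L z)) > 0\<close>
        by (intro add_pos_pos mult_pos_pos) auto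
      moreover have "Re (P t z) = t * Re (exp (of_real (x - 1) * L z)) + (1 - t) * Re (1 + z * deriv L z)"
        unfolding P_def by (simp del: Re_exp)
      ultimately show ?thesis by simp
    qed
    moreover have "Re (P 0 z) > 0" "Re (P 1 z) > 0"
      using pos[OF inR[OF that(2)]] \<open>Re (exp (of_real (x - 1) * L z)) > 0\<close> by (simp_all add: P_def)
    ultimately show ?thesis by blast
  qed
  show "z1 = z2"
  proof (rule unique_zero_by_deformation[of h A B])
    fix t :: real and z :: complex assume tz: "t \<in> {0..1}" "z \<in> cball 0 1"
    have "((\<lambda>z. exp (L z)) has_field_derivative exp (L z) * deriv L z) (at z)"
      using holomorphic_derivI[OF hol open_ball inR[OF tz(2)]] by (auto intro!: derivative_eq_intros)
    then have dL: "((\<lambda>z. exp (L z)) has_derivative (*) (exp (L z) * deriv L z)) (at z)" and dF: "(F has_derivative (*) (exp (of_real x * L z))) (at z)"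
      using F[OF inR[OF tz(2)]] by (simp_all add: has_field_derivative_def)
    have dsnd: "(snd has_derivative snd) (at (t, z))"
      by (rule has_derivative_snd[OF has_derivative_ident, unfolded id_def])
    have dL': "((\<lambda>y. exp (L (snd y))) has_derivative (\<lambda>y. exp (L z) * deriv L z * snd y)) (at (t, z))"
      and dF': "((\<lambda>y. F (snd y)) has_derivative (\<lambda>y. exp (of_real x * L z) * snd y)) (at (t, z))"
      using has_derivative_compose[OF dsnd, of "\<lambda>z. exp (L z)" "(*) (exp (L z) * deriv L z)"] dL
        has_derivative_compose[OF dsnd, of F "(*) (exp (of_real x * L z))"] dF by simp_all
    have "((\<lambda>y. h (fst y) (snd y)) has_derivative
        (\<lambda>y. of_real (fst y) * (F z - v) + of_real t * (exp (of_real x * L z) * snd y)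
          + ((1 - of_real t) * (snd y * exp (L z) + z * (exp (L z) * (deriv L z * snd y)))
          - of_real (fst y) * (z * exp (L z))))) (at (t, z))"
      unfolding h_def
      by (rule derivative_eq_intros refl dL' dF')+ (simp add: fun_eq_iff algebra_simps)
    then show "((\<lambda>y. h (fst y) (snd y)) has_derivative (\<lambda>y. of_real (fst y) * A t z + B t z * snd y)) (at (t, z))"
      unfolding A_def B_def P_def split by (simp add: algebra_simps)
    show "B t z \<noteq> 0" using Ppos[OF tz] by (auto simp: B_def)
  next
    have c: "continuous_on ({0..1} \<times> cball 0 1) (\<lambda>x. G (snd x))"
      if "G holomorphic_on ball 0 R" for G
      using inR by (intro continuous_on_compose2[OF holomorphic_on_imp_continuous_on[OF that]] continuous_intros) auto
    show "continuous_on ({0..1} \<times> cball 0 1) (\<lambda>x. B (fst x) (snd x))"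
      unfolding B_def P_def
      by (intro continuous_intros c hol holomorphic_intros) auto
  next
    fix t :: real and z :: complex assume t: "0 < t" "t < 1" and z: "cmod z = 1" and h0: "h t z = 0"
    have P: "Re (P t z) > 0" using Ppos t z by simp
    then have "P t z \<noteq> 0" by auto
    have "of_real t * (F z - v) = - ((1 - of_real t) * z * exp (L z))"
      using h0 unfolding h_def by (simp add: add_eq_0_iff2)
    then have "of_real t * A t z = - (z * exp (L z))"
      unfolding A_def by (simp add: right_diff_distrib) (simp add: algebra_simps)
    also have "\<dots> = - (z * B t z * (1 / P t z))" using \<open>P t z \<noteq> 0\<close> by (simp add: B_def)
    finally show "Re (cnj z * (A t z / B t z)) < 0"
    proof (rule inward_velocity[OF t(1)])
      show "Re (1 / P t z) > 0" using P by (simp add: Re_divide sum_power2_gt_zero_iff)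
    qed (use z \<open>P t z \<noteq> 0\<close> in \<open>auto simp: B_def\<close>)
  next
    show "z = 0" if "h 0 z = 0" for z using that by (simp add: h_def)
  qed (use z12 in \<open>auto simp: h_def v_def\<close>)
qed

text \<open>Both chains use data holomorphic beyond the closed disk. Dilation by some
  \<open>r < 1\<close> exceeding the moduli of the two given points provides this. The exponent
  \<open>1 / 2\<close>, where the first chain degenerates, falls to the second.\<close>

lemma univalent_exp_multiple:
  assumes hol: "L holomorphic_on ball 0 1" and L0: "L 0 = 0"
    and pos: "\<And>z. z \<in> ball 0 1 \<Longrightarrow> Re (1 + z * deriv L z) > 0"
    and F: "\<And>z. z \<in> ball 0 1 \<Longrightarrow> (F has_field_derivative exp (\<delta> * L z)) (at z)"
    and \<delta>: "cmod \<delta> \<le> 1 / 2 \<or> (\<exists>x. \<delta> = of_real x \<and> 1 / 2 \<le> x \<and> x \<le> 3 / 2)"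
  shows "inj_on F (ball 0 1)"
proof (rule inj_onI)
  fix a b assume ab: "a \<in> ball 0 1" "b \<in> ball 0 1" "F a = F b"
  obtain r where r: "max (cmod a) (cmod b) < r" "r < 1"
    using ab dense[of "max (cmod a) (cmod b)" 1] by auto
  have "r > 0" using r(1) by (meson less_le_trans max.strict_boundedE norm_ge_zero not_le)
  define L' where "L' = (\<lambda>z. L (of_real r * z))"
  define F' where "F' = (\<lambda>z. F (of_real r * z) / of_real r)"
  have in1: "of_real r * z \<in> ball 0 1" if "z \<in> ball 0 (1 / r)" for z :: complex
    using that \<open>r > 0\<close> by (simp add: norm_mult field_simps)
  have dL: "(L' has_field_derivative of_real r * deriv L (of_real r * z)) (at z)" if "z \<in> ball 0 (1 / r)" for z
    unfolding L'_def
    using DERIV_chain2[where f = L and g = "(*) (of_real r)", OF holomorphic_derivI[OF hol open_ball in1[OF that]] DERIV_cmult_Id]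
    by (simp add: mult.commute)
  have holL: "L' holomorphic_on ball 0 (1 / r)"
    using dL by (subst holomorphic_on_open) blast+
  have posL: "Re (1 + z * deriv L' z) > 0" if "z \<in> ball 0 (1 / r)" for z
    using pos[OF in1[OF that]] DERIV_imp_deriv[OF dL[OF that]] by (simp add: mult_ac)
  have dF: "(F' has_field_derivative exp (\<delta> * L' z)) (at z)" if "z \<in> ball 0 (1 / r)" for z
    unfolding F'_def L'_def
    using DERIV_cdivide[OF DERIV_chain2[where f = F and g = "(*) (of_real r)", OF F[OF in1[OF that]] DERIV_cmult_Id],
        of "of_real r"] \<open>r > 0\<close>
    by simp
  have "1 / r > 1" using r \<open>r > 0\<close> by simp
  have "L' 0 = 0" by (simp add: L'_def L0)
  have "inj_on F' (ball 0 1)"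
  proof (cases "\<exists>x. \<delta> = of_real x \<and> 1 / 2 \<le> x \<and> x \<le> 3 / 2")
    case True
    then obtain x where x: "\<delta> = of_real x" "1 / 2 \<le> x" "x \<le> 3 / 2" by blast
    show ?thesis
      by (rule univalent_close_to_convex_chain[OF \<open>1 / r > 1\<close> holL \<open>L' 0 = 0\<close> posL dF[unfolded x(1)] x(2,3)])
  next
    case False
    have "\<delta> \<noteq> 1 / 2"
    proof
      assume "\<delta> = 1 / 2"
      then have "\<delta> = of_real (1 / 2)" by simp
      then show False using False by (metis order.refl divide_right_mono one_le_numeral zero_le_numeral)
    qed
    then show ?thesis
      using univalent_Ahlfors_chain[OF \<open>1 / r > 1\<close> holL posL dF] \<delta> False by blast
  qed
  moreover have "F' (a / of_real r) = F' (b / of_real r)"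
    using ab \<open>r > 0\<close> by (simp add: F'_def)
  moreover have "a / of_real r \<in> ball 0 1" "b / of_real r \<in> ball 0 1"
    using r \<open>r > 0\<close> by (simp_all add: norm_divide)
  ultimately have "a / of_real r = b / of_real r" by (rule inj_onD)
  then show "a = b" using \<open>r > 0\<close> by simp
qed

section \<open>Spirallike functions\<close>

text \<open>Differentiating the equal exponentials gives equal derivatives, so \<open>g - h\<close>
  is constant. This is the uniqueness behind the definite description in
  \<open>logquot\<close>.\<close>

lemma holomorphic_log_unique:
  assumes g: "g holomorphic_on ball 0 1" and h: "h holomorphic_on ball 0 1" and "g 0 = h 0"
    and eq: "\<And>z. z \<in> ball 0 1 \<Longrightarrow> exp (g z) = exp (h z)" and z: "z \<in> ball 0 1"
  shows "g z = h z"
proof -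
  have "((\<lambda>z. g z - h z) has_field_derivative 0) (at x within ball 0 1)" if x: "x \<in> ball 0 1" for x
  proof -
    note dg = holomorphic_derivI[OF g open_ball x] and dh = holomorphic_derivI[OF h open_ball x]
    have eg: "((\<lambda>z. exp (g z)) has_field_derivative exp (g x) * deriv g x) (at x)"
      using dg by (auto intro!: derivative_eq_intros)
    have "((\<lambda>z. exp (h z)) has_field_derivative exp (h x) * deriv h x) (at x)"
      using dh by (auto intro!: derivative_eq_intros)
    then have "((\<lambda>z. exp (g z)) has_field_derivative exp (h x) * deriv h x) (at x)"
      by (rule has_field_derivative_transform_within_open[OF _ open_ball x]) (simp add: eq)
    from DERIV_unique[OF eg this] have "deriv g x = deriv h x" using eq[OF x] by simp
    then show ?thesis
      using DERIV_diff[OF dg dh] by (simp add: has_field_derivative_at_within)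
  qed
  then obtain c where "\<And>x. x \<in> ball 0 1 \<Longrightarrow> g x - h x = c"
    using has_field_derivative_zero_constant[OF convex_ball, of 0 1 "\<lambda>z. g z - h z"] by blast
  from this[of 0] this[of z] show ?thesis using z \<open>g 0 = h 0\<close> by simp
qed

lemma logquot_eq:
  assumes "h holomorphic_on unit_disk" "h 0 = 0" "\<And>w. w \<in> unit_disk \<Longrightarrow> exp (h w) = quot0 f w" "z \<in> unit_disk"
  shows "logquot f z = h z"
proof -
  \<comment> \<open>The description in \<open>logquot\<close> prescribes the value 0 off the disk,
    so the candidate is cut off there.\<close>
  define h' where "h' = (\<lambda>w. if w \<in> unit_disk then h w else 0)"
  have hol': "h' holomorphic_on unit_disk"
    using assms(1) by (rule holomorphic_transform) (simp add: h'_def)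
  have "logquot f = h'"
    unfolding logquot_def
  proof (rule the_equality)
    show "h' holomorphic_on unit_disk \<and> h' 0 = 0 \<and> (\<forall>w\<in>unit_disk. exp (h' w) = quot0 f w) \<and>
        (\<forall>w. w \<notin> unit_disk \<longrightarrow> h' w = 0)"
      using hol' assms by (simp add: h'_def)
    fix g assume g: "g holomorphic_on unit_disk \<and> g 0 = 0 \<and> (\<forall>w\<in>unit_disk. exp (g w) = quot0 f w) \<and>
        (\<forall>w. w \<notin> unit_disk \<longrightarrow> g w = 0)"
    show "g = h'"
    proof
      fix w
      show "g w = h' w"
      proof (cases "w \<in> unit_disk")
        case True
        have "g w = h w" using g assms by (intro holomorphic_log_unique[OF _ assms(1) _ _ True]) auto
        then show ?thesis using True by (simp add: h'_def)
      next
        case False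
        then show ?thesis using g by (simp add: h'_def)
      qed
    qed
  qed
  then show ?thesis using assms(4) by (simp add: h'_def)
qed

lemma Jop_has_field_derivative:
  assumes hol: "h holomorphic_on unit_disk" and eq: "\<And>w. w \<in> unit_disk \<Longrightarrow> logquot f w = h w"
    and z: "z \<in> unit_disk"
  shows "(Jop \<gamma> f has_field_derivative exp (\<gamma> * h z)) (at z)"
proof -
  have "(\<lambda>w. exp (\<gamma> * h w)) holomorphic_on unit_disk" by (intro holomorphic_intros hol)
  then obtain g where g: "\<And>x. x \<in> unit_disk \<Longrightarrow> (g has_field_derivative exp (\<gamma> * h x)) (at x within unit_disk)"
    using holomorphic_convex_primitive'[OF convex_ball open_ball] by blast
  have J: "Jop \<gamma> f x = g x - g 0" if "x \<in> unit_disk" for x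
  proof -
    have sub: "path_image (linepath 0 x) \<subseteq> unit_disk"
      using that by (simp add: closed_segment_subset)
    have "((\<lambda>w. exp (\<gamma> * h w)) has_contour_integral (g x - g 0)) (linepath 0 x)"
      using contour_integral_primitive[OF g valid_path_linepath sub] by simp
    then have "((\<lambda>w. exp (\<gamma> * logquot f w)) has_contour_integral (g x - g 0)) (linepath 0 x)"
      by (rule has_contour_integral_eq) (use sub eq in auto)
    then show ?thesis unfolding Jop_def by (rule contour_integral_unique)
  qed
  have "((\<lambda>x. g x - g 0) has_field_derivative exp (\<gamma> * h z) - 0) (at z)"
    using g[OF z] at_within_open[OF z open_ball] by (intro DERIV_diff) auto
  then have "((\<lambda>x. g x - g 0) has_field_derivative exp (\<gamma> * h z)) (at z)" by simp
  then show ?thesis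
    by (rule has_field_derivative_transform_within_open[OF _ open_ball z]) (simp add: J)
qed

lemma Jop_in_classS_iff:
  assumes hol: "h holomorphic_on unit_disk" and h0: "h 0 = 0"
    and eq: "\<And>w. w \<in> unit_disk \<Longrightarrow> logquot f w = h w"
  shows "Jop \<gamma> f \<in> classS \<longleftrightarrow> inj_on (Jop \<gamma> f) unit_disk"
proof -
  note der = Jop_has_field_derivative[OF hol eq]
  have "Jop \<gamma> f holomorphic_on unit_disk"
    using der by (subst holomorphic_on_open) blast+
  moreover have "Jop \<gamma> f 0 = 0" by (simp add: Jop_def)
  moreover have "deriv (Jop \<gamma> f) 0 = 1"
    using DERIV_imp_deriv[OF der[of 0]] h0 by simp
  ultimately show ?thesis by (simp add: classS_def classA_def)
qed

text \<open>With \<open>c\<close> this factor, \<open>f\<close> is spirallike iff \<open>(f(z)/z)\<^bsup>1/c\<^esup>\<close> is the derivative of a convex function.\<close>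
definition spiral_factor :: "real \<Rightarrow> real \<Rightarrow> complex" where
  "spiral_factor \<alpha> l = exp (- \<i> * of_real \<alpha>) * of_real ((1 - l) * cos \<alpha>)"

text \<open>The rotation in \<open>spiral_factor\<close> cancels: its product with
  \<open>exp (\<i> * \<alpha>)\<close> is the real number
  \<open>(1 - l) * cos \<alpha>\<close>.\<close>

lemma Re_spiral_condition_iff:
  "Re (exp (\<i> * of_real \<alpha>) * (1 + spiral_factor \<alpha> l * w)) > l * cos \<alpha> \<longleftrightarrow> (1 - l) * cos \<alpha> * Re (1 + w) > 0"
proof -
  have "exp (\<i> * of_real \<alpha>) * spiral_factor \<alpha> l = of_real ((1 - l) * cos \<alpha>)"
    unfolding spiral_factor_def by (simp add: mult.assoc[symmetric] exp_add[symmetric])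
  then have "exp (\<i> * of_real \<alpha>) * (1 + spiral_factor \<alpha> l * w)
      = exp (\<i> * of_real \<alpha>) + of_real ((1 - l) * cos \<alpha>) * w"
    by (simp add: distrib_left mult.assoc[symmetric])
  then have "Re (exp (\<i> * of_real \<alpha>) * (1 + spiral_factor \<alpha> l * w)) = cos \<alpha> + (1 - l) * cos \<alpha> * Re w"
    by (simp add: Re_exp)
  then show ?thesis by (simp only:) (simp add: algebra_simps)
qed

text \<open>For this \<open>f\<close> the quotient \<open>z * f' / f\<close> is
  \<open>1 + c * z * L'\<close>. The lemma supplies the test functions for necessity.\<close>

lemma spirallike_of_convex_log:
  assumes hol: "L holomorphic_on unit_disk" and L0: "L 0 = 0"
    and pos: "\<And>z. z \<in> unit_disk \<Longrightarrow> Re (1 + z * deriv L z) > 0"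
    and \<kappa>: "(1 - l) * cos \<alpha> > 0"
  defines "c \<equiv> spiral_factor \<alpha> l"
  shows "(\<lambda>z. z * exp (c * L z)) \<in> spirallike \<alpha> l"
proof -
  define f where "f = (\<lambda>z. z * exp (c * L z))"
  have der: "(f has_field_derivative exp (c * L z) * (1 + c * (z * deriv L z))) (at z)" if "z \<in> unit_disk" for z
    unfolding f_def using holomorphic_derivI[OF hol open_ball that]
    by (auto intro!: derivative_eq_intros simp: algebra_simps)
  have "f holomorphic_on unit_disk" unfolding f_def by (intro holomorphic_intros hol)
  moreover have "f 0 = 0" by (simp add: f_def)
  moreover have "deriv f 0 = 1" using DERIV_imp_deriv[OF der[of 0]] by (simp add: L0)
  moreover have "f z \<noteq> 0" if "z \<noteq> 0" for z using that by (simp add: f_def)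
  moreover have "Re (exp (\<i> * of_real \<alpha>) * z * deriv f z / f z) > l * cos \<alpha>" if "z \<in> unit_disk" "z \<noteq> 0" for z
  proof -
    have "exp (\<i> * of_real \<alpha>) * z * deriv f z / f z = exp (\<i> * of_real \<alpha>) * (1 + c * (z * deriv L z))"
      using that DERIV_imp_deriv[OF der[OF that(1)]] by (simp add: f_def)
    then show ?thesis using Re_spiral_condition_iff[of l \<alpha> "z * deriv L z"] pos[OF that(1)] \<kappa>
      unfolding c_def by simp
  qed
  ultimately show ?thesis unfolding spirallike_def classA_def f_def[symmetric] by blast
qed

text \<open>\<open>f z / z\<close> extends to a zero-free function on the disk and so has a
  holomorphic logarithm \<open>g\<close>. Since \<open>exp (g 0) = 1\<close>, subtracting
  \<open>g 0\<close> normalises it; dividing by \<open>c\<close> gives \<open>L\<close>.\<close>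

lemma spirallike_convex_log:
  assumes f: "f \<in> spirallike \<alpha> l" and \<kappa>: "(1 - l) * cos \<alpha> > 0"
  defines "c \<equiv> spiral_factor \<alpha> l"
  obtains L where "L holomorphic_on unit_disk" "L 0 = 0"
    "\<And>z. z \<in> unit_disk \<Longrightarrow> Re (1 + z * deriv L z) > 0"
    "\<And>z. z \<in> unit_disk \<Longrightarrow> logquot f z = c * L z"
proof -
  have c0: "c \<noteq> 0" using \<kappa> by (auto simp: c_def spiral_factor_def)
  have fA: "f holomorphic_on unit_disk" "f 0 = 0" "deriv f 0 = 1"
    and nz: "\<And>z. z \<in> unit_disk \<Longrightarrow> z \<noteq> 0 \<Longrightarrow> f z \<noteq> 0"
    and re: "\<And>z. z \<in> unit_disk \<Longrightarrow> z \<noteq> 0 \<Longrightarrow> Re (exp (\<i> * of_real \<alpha>) * z * deriv f z / f z) > l * cos \<alpha>"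
    using f by (auto simp: spirallike_def classA_def)
  obtain q where q: "q holomorphic_on ball 0 1" "\<And>z. cmod z < 1 \<Longrightarrow> f z = z * q z" "deriv f 0 = q 0"
    using Schwarz3[OF fA(1,2)] by blast
  have qq: "q z = quot0 f z" if "z \<in> unit_disk" for z
    using q(2)[of z] q(3) fA(3) that by (simp add: quot0_def)
  have nzq: "q z \<noteq> 0" if "z \<in> ball 0 1" for z
    using qq[OF that] nz[OF that] by (simp add: quot0_def split: if_splits)
  obtain g where g: "g holomorphic_on ball 0 1" "\<And>z. z \<in> ball 0 1 \<Longrightarrow> exp (g z) = q z"
    using holomorphic_logarithm_exists[OF convex_ball open_ball q(1) nzq, of 0] by auto
  define L where "L = (\<lambda>z. (g z - g 0) / c)"
  have holL: "L holomorphic_on unit_disk" unfolding L_def using c0 by (intro holomorphic_intros g) auto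
  have L0: "L 0 = 0" by (simp add: L_def)
  have eL: "exp (c * L z) = quot0 f z" if "z \<in> unit_disk" for z
    using g(2)[OF that] g(2)[of 0] qq[OF that] q(3) fA(3) c0 by (simp add: L_def exp_diff)
  have "logquot f z = c * L z" if "z \<in> unit_disk" for z
    using holL L0 eL that by (intro logquot_eq) (auto intro!: holomorphic_intros)
  moreover have "Re (1 + z * deriv L z) > 0" if z: "z \<in> unit_disk" for z
  proof (cases "z = 0")
    case True
    then show ?thesis by simp
  next
    case False
    have "((\<lambda>z. z * exp (c * L z)) has_field_derivative exp (c * L z) * (1 + c * (z * deriv L z))) (at z)"
      using holomorphic_derivI[OF holL open_ball z]
      by (auto intro!: derivative_eq_intros simp: algebra_simps)
    then have "(f has_field_derivative exp (c * L z) * (1 + c * (z * deriv L z))) (at z)"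
      by (rule has_field_derivative_transform_within_open[OF _ open_ball z])
         (use eL fA(2) in \<open>auto simp: quot0_def\<close>)
    then have "deriv f z = exp (c * L z) * (1 + c * (z * deriv L z))" by (rule DERIV_imp_deriv)
    moreover have "f z = z * exp (c * L z)" using eL[OF z] False by (simp add: quot0_def)
    ultimately have "exp (\<i> * of_real \<alpha>) * z * deriv f z / f z = exp (\<i> * of_real \<alpha>) * (1 + c * (z * deriv L z))"
      using False by simp
    then have "(1 - l) * cos \<alpha> * Re (1 + z * deriv L z) > 0"
      using re[OF z False] Re_spiral_condition_iff[of l \<alpha> "z * deriv L z"] unfolding c_def by simp
    then show ?thesis using \<kappa> by (metis zero_less_mult_pos)
  qed
  ultimately show thesis using that holL L0 by blast
qed

section \<open>Non-univalent powers\<close>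

text \<open>The hypotheses amount to \<open>2 * \<bar>Re \<nu>\<bar> < (cmod \<nu>)\<^sup>2\<close>,
  so the period \<open>d\<close> of \<open>exp (\<nu> * y)\<close> in \<open>y\<close> has
  \<open>\<bar>Im d\<bar> < pi\<close>. In the coordinate \<open>y = Ln a\<close> the disk
  \<open>cmod (1 - a) < 1\<close> becomes \<open>\<bar>Im y\<bar> < pi / 2\<close>,
  \<open>Re y < ln (2 * cos (Im y))\<close>. It contains \<open>- N + d / 2\<close> and
  \<open>- N - d / 2\<close> for large \<open>N\<close>, and these differ by a period.\<close>

lemma power_not_injective_on_disk:
  assumes "cmod (\<nu> - 1) > 1" "cmod (\<nu> + 1) > 1"
  obtains z1 z2 where "z1 \<in> ball 0 1" "z2 \<in> ball 0 1" "z1 \<noteq> z2"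
    "exp (\<nu> * Ln (1 - z1)) = exp (\<nu> * Ln (1 - z2))"
proof -
  have "\<nu> \<noteq> 0" using assms by auto
  define d where "d = 2 * of_real pi * \<i> / \<nu>"
  have d0: "d \<noteq> 0" using \<open>\<nu> \<noteq> 0\<close> by (simp add: d_def)
  have "(cmod (\<nu> - 1))\<^sup>2 > 1" "(cmod (\<nu> + 1))\<^sup>2 > 1"
    using assms by (simp_all add: one_less_power)
  then have re: "2 * \<bar>Re \<nu>\<bar> < (cmod \<nu>)\<^sup>2"
    unfolding cmod_power2 by (auto simp: abs_if power2_eq_square algebra_simps)
  have "Im d = 2 * pi * Re \<nu> / (cmod \<nu>)\<^sup>2"
    by (simp add: d_def Im_divide cmod_power2)
  then have "\<bar>Im d\<bar> = pi * (2 * \<bar>Re \<nu>\<bar> / (cmod \<nu>)\<^sup>2)"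
    by (simp add: abs_mult)
  also have "\<dots> < pi * 1"
    using re \<open>\<nu> \<noteq> 0\<close> by (intro mult_strict_left_mono) (auto simp: divide_less_eq)
  finally have imd: "\<bar>Im d\<bar> < pi" by simp
  define k where "k = 2 * cos (Im d / 2)"
  have k: "k > 0" unfolding k_def using imd by (auto intro!: cos_gt_zero_pi simp: abs_less_iff)
  \<comment> \<open>This makes \<open>Re e - N < ln k\<close> for both signs, that is,
    \<open>cmod a < 2 * cos (Im e)\<close>.\<close>
  define N where "N = \<bar>Re d\<bar> / 2 - ln k + 1"
  have *: "1 - exp (- of_real N + e) \<in> ball 0 1" "Ln (exp (- of_real N + e)) = - of_real N + e"
    if e: "e = d / 2 \<or> e = - d / 2" for e
  proof -
    have ime: "\<bar>Im e\<bar> < pi / 2" "cos (Im e) = k / 2" "Re e \<le> \<bar>Re d\<bar> / 2"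
      using e imd by (auto simp: k_def)
    show "Ln (exp (- of_real N + e)) = - of_real N + e"
      using ime(1) by (intro Ln_exp) auto
    define a where "a = exp (- of_real N + e)"
    have "cmod a = exp (Re e - N)" by (simp add: a_def)
    also have "\<dots> < exp (ln k)" using ime(3) by (subst exp_less_cancel_iff) (simp add: N_def)
    finally have "cmod a < k" using k by simp
    then have "cmod a * cmod a < cmod a * k"
      by (intro mult_strict_left_mono) (auto simp: a_def)
    moreover have "Re a = cmod a * (k / 2)"
      using ime(2) by (simp add: a_def Re_exp)
    ultimately have "(cmod a)\<^sup>2 < 2 * Re a" by (simp add: power2_eq_square)
    then have "(cmod (1 - a))\<^sup>2 < 1\<^sup>2"
      unfolding cmod_power2 by (simp add: power2_eq_square algebra_simps)
    then have "cmod (1 - a) < 1" by (rule power2_less_imp_less) simp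
    then show "1 - exp (- of_real N + e) \<in> ball 0 1" by (simp add: a_def)
  qed
  define z1 where "z1 = 1 - exp (- of_real N + d / 2)"
  define z2 where "z2 = 1 - exp (- of_real N + - d / 2)"
  have l: "Ln (1 - z1) = - of_real N + d / 2" "Ln (1 - z2) = - of_real N + - d / 2"
    using *(2)[of "d / 2"] *(2)[of "- d / 2"] by (simp_all add: z1_def z2_def)
  show thesis
  proof (rule that)
    show "z1 \<in> ball 0 1" "z2 \<in> ball 0 1"
      unfolding z1_def z2_def by (intro *(1); simp)+
    show "z1 \<noteq> z2"
    proof
      assume "z1 = z2"
      with l have "d / 2 = - d / 2" by simp
      then show False using d0 by simp
    qed
    have "\<nu> * Ln (1 - z1) = \<nu> * Ln (1 - z2) + 2 * of_real pi * \<i>"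
      unfolding l using \<open>\<nu> \<noteq> 0\<close> by (simp add: d_def field_simps)
    then show "exp (\<nu> * Ln (1 - z1)) = exp (\<nu> * Ln (1 - z2))"
      by (simp add: exp_add)
  qed
qed

text \<open>The unit disks centred at \<open>0\<close> and \<open>2\<close> touch only at \<open>1\<close>, so a segment from \<open>0\<close> that
  leaves the first one elsewhere leaves their union.\<close>
lemma segment_leaves_tangent_disks:
  fixes \<zeta> :: complex
  assumes "cmod \<zeta> > 1" and nr: "\<not> (\<exists>x. \<zeta> = of_real x \<and> 1 \<le> x \<and> x \<le> 3)"
  obtains \<mu> where "0 < \<mu>" "\<mu> \<le> 1" "cmod (of_real \<mu> * \<zeta>) > 1" "cmod (of_real \<mu> * \<zeta> - 2) > 1"
proof (cases "cmod (\<zeta> - 2) > 1")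
  case True
  then show thesis using that[of 1] assms by simp
next
  case False
  define n where "n = cmod \<zeta>"
  \<comment> \<open>\<open>x\<close> is the cosine of the argument of \<open>\<zeta>\<close>. If it
    were 1, \<open>\<zeta>\<close> would be real, and being within 1 of 2 it would lie in the
    excluded interval.\<close>
  define x where "x = Re \<zeta> / n"
  have n: "n > 1" using assms by (simp add: n_def)
  have "x < 1"
  proof (rule ccontr)
    assume "\<not> x < 1"
    then have "Re \<zeta> \<ge> n" using n by (simp add: x_def field_simps)
    then have re: "Re \<zeta> = n" using complex_Re_le_cmod[of \<zeta>] by (simp add: n_def)
    then have "Im \<zeta> = 0" unfolding n_def using cmod_power2[of \<zeta>] by (metis add_cancel_left_right zero_eq_power2)
    then have z: "\<zeta> = of_real n" using re by (simp add: complex_eq_iff)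
    then have "\<bar>n - 2\<bar> \<le> 1" using False by (metis norm_of_real of_real_diff of_real_numeral not_le)
    then show False using nr z n by force
  qed
  \<comment> \<open>The point sought has modulus \<open>m = 1 + \<epsilon>\<close>. The bound
    \<open>n - 1\<close> keeps it on the segment, and the bound \<open>1 - x\<close> makes
    \<open>4 * (1 - x) - 2 * \<epsilon>\<close> positive in its squared distance from 2.\<close>
  define \<epsilon> where "\<epsilon> = min (n - 1) (1 - x)"
  define m where "m = 1 + \<epsilon>"
  have \<epsilon>: "\<epsilon> > 0" "\<epsilon> \<le> n - 1" "\<epsilon> \<le> 1 - x" using n \<open>x < 1\<close> by (auto simp: \<epsilon>_def)
  define \<mu> where "\<mu> = m / n"
  have m: "m > 1" "m \<le> n" using \<epsilon> by (auto simp: m_def)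
  show thesis
  proof (rule that[of \<mu>])
    show "0 < \<mu>" "\<mu> \<le> 1" using m n by (auto simp: \<mu>_def)
    show "cmod (of_real \<mu> * \<zeta>) > 1" using m n by (simp add: \<mu>_def norm_mult n_def[symmetric] norm_divide)
    have re: "\<mu> * Re \<zeta> = m * x" by (simp add: \<mu>_def x_def)
    have "(\<mu> * Re \<zeta>)\<^sup>2 + (\<mu> * Im \<zeta>)\<^sup>2 = \<mu>\<^sup>2 * n\<^sup>2"
      unfolding n_def cmod_power2 by (simp add: algebra_simps)
    also have "\<dots> = m\<^sup>2" using n by (simp add: \<mu>_def power_divide)
    finally have sq: "(\<mu> * Re \<zeta>)\<^sup>2 + (\<mu> * Im \<zeta>)\<^sup>2 = m\<^sup>2" .
    have "(cmod (of_real \<mu> * \<zeta> - 2))\<^sup>2 = ((\<mu> * Re \<zeta>)\<^sup>2 + (\<mu> * Im \<zeta>)\<^sup>2) - 4 * (\<mu> * Re \<zeta>) + 4"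
      unfolding cmod_power2 by (simp add: power2_eq_square algebra_simps)
    also have "\<dots> = m\<^sup>2 - 4 * (m * x) + 4" by (simp only: sq) (simp only: re)
    also have "\<dots> = 1 + (4 * (1 - x) - 2 * \<epsilon>) + 4 * \<epsilon> * (1 - x) + \<epsilon>\<^sup>2"
      by (simp add: m_def power2_eq_square algebra_simps)
    also have "\<dots> > 1"
    proof -
      have "4 * \<epsilon> * (1 - x) \<ge> 0" "\<epsilon>\<^sup>2 \<ge> 0" using \<epsilon> \<open>x < 1\<close> by simp_all
      moreover have "4 * (1 - x) - 2 * \<epsilon> > 0" using \<epsilon> \<open>x < 1\<close> by (simp add: algebra_simps)
      ultimately show ?thesis by (metis add.assoc add_pos_nonneg less_add_same_cancel1)
    qed
    finally have "1\<^sup>2 < (cmod (of_real \<mu> * \<zeta> - 2))\<^sup>2" by simp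
    then show "cmod (of_real \<mu> * \<zeta> - 2) > 1" by (rule power2_less_imp_less) simp
  qed
qed

section \<open>The set of exponents\<close>

lemma exponent_necessary:
  fixes \<gamma> :: complex
  assumes \<kappa>: "(1 - l) * cos \<alpha> > 0" and J: "\<And>f. f \<in> spirallike \<alpha> l \<Longrightarrow> Jop \<gamma> f \<in> classS"
  defines "\<delta> \<equiv> spiral_factor \<alpha> l * \<gamma>"
  shows "cmod \<delta> \<le> 1 / 2 \<or> (\<exists>x. \<delta> = of_real x \<and> 1 / 2 \<le> x \<and> x \<le> 3 / 2)"
proof (rule ccontr)
  assume contra: "\<not> ?thesis"
  define c where "c = spiral_factor \<alpha> l"
  have "cmod (2 * \<delta>) > 1" using contra by (simp add: norm_mult)
  moreover have "\<not> (\<exists>x. 2 * \<delta> = of_real x \<and> 1 \<le> x \<and> x \<le> 3)"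
  proof
    assume "\<exists>x. 2 * \<delta> = of_real x \<and> 1 \<le> x \<and> x \<le> 3"
    then obtain x where "2 * \<delta> = of_real x" "1 \<le> x" "x \<le> 3" by blast
    then have "\<delta> = of_real (x / 2)" "1 / 2 \<le> x / 2" "x / 2 \<le> 3 / 2" by (auto simp: field_simps)
    then show False using contra by blast
  qed
  ultimately obtain \<mu> where \<mu>: "0 < \<mu>" "\<mu> \<le> 1" "cmod (of_real \<mu> * (2 * \<delta>)) > 1" "cmod (of_real \<mu> * (2 * \<delta>) - 2) > 1"
    by (rule segment_leaves_tangent_disks)
  define \<nu> where "\<nu> = 1 - of_real \<mu> * (2 * \<delta>)"
  have \<nu>: "cmod (\<nu> - 1) > 1" "cmod (\<nu> + 1) > 1"
    using \<mu>(3,4) by (simp_all add: \<nu>_def norm_minus_commute)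
  then have "\<nu> \<noteq> 0" by auto
  obtain z1 z2 where z: "z1 \<in> ball 0 1" "z2 \<in> ball 0 1" "z1 \<noteq> z2"
    "exp (\<nu> * Ln (1 - z1)) = exp (\<nu> * Ln (1 - z2))"
    using power_not_injective_on_disk[OF \<nu>] .
  have re1: "Re (1 - x) > 0" if "x \<in> unit_disk" for x
    using that complex_Re_le_cmod[of x] by simp
  then have nonpos: "1 - x \<notin> \<real>\<^sub>\<le>\<^sub>0" "1 - x \<noteq> 0" if "x \<in> unit_disk" for x
    using that by (force simp: complex_nonpos_Reals_iff)+
  define L where "L = (\<lambda>x. - 2 * of_real \<mu> * Ln (1 - x))"
  have dL: "(L has_field_derivative 2 * of_real \<mu> / (1 - x)) (at x)" if "x \<in> unit_disk" for x
    unfolding L_def using nonpos[OF that] by (auto intro!: derivative_eq_intros simp: field_simps)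
  have holL: "L holomorphic_on unit_disk" using dL by (subst holomorphic_on_open) blast+
  have L0: "L 0 = 0" by (simp add: L_def)
  have posL: "Re (1 + x * deriv L x) > 0" if x: "x \<in> unit_disk" for x
  proof -
    \<comment> \<open>A convex combination of 1 and the half-plane map; this is where
      \<open>\<mu> \<le> 1\<close> enters.\<close>
    have "1 + x * deriv L x = of_real (1 - \<mu>) + of_real \<mu> * ((1 + x) / (1 - x))"
      unfolding DERIV_imp_deriv[OF dL[OF x]] using nonpos[OF x] by (simp add: field_simps)
    then have "Re (1 + x * deriv L x) = (1 - \<mu>) + \<mu> * Re ((1 + x) / (1 - x))"
      by (simp del: times_divide_eq_right)
    moreover have "\<mu> * Re ((1 + x) / (1 - x)) > 0"
      using Re_one_plus_over_one_minus_pos[of x] x \<mu>(1) by simp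
    ultimately show ?thesis using \<mu>(2) by linarith
  qed
  define f where "f = (\<lambda>z. z * exp (c * L z))"
  have "f \<in> spirallike \<alpha> l"
    unfolding f_def c_def by (rule spirallike_of_convex_log[OF holL L0 posL \<kappa>])
  then have "Jop \<gamma> f \<in> classS" by (rule J)
  then have inj: "inj_on (Jop \<gamma> f) unit_disk" by (simp add: classS_def)
  have lq: "logquot f x = c * L x" if "x \<in> unit_disk" for x
    using that holL L0 by (intro logquot_eq) (auto intro!: holomorphic_intros simp: f_def quot0_def)
  have hc: "(\<lambda>x. c * L x) holomorphic_on unit_disk" by (intro holomorphic_intros holL)
  \<comment> \<open>\<open>G\<close> is \<open>- (1 - x)\<close> to the power \<open>\<nu>\<close>,
    over \<open>\<nu>\<close>, read as minus the power. Its derivative is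
    \<open>exp ((\<nu> - 1) * Ln (1 - x)) = exp (\<delta> * L x)\<close>, so
    \<open>Jop \<gamma> f\<close> differs from it by a constant.\<close>
  define G where "G = (\<lambda>x. - exp (\<nu> * Ln (1 - x)) / \<nu>)"
  have "((\<lambda>x. Jop \<gamma> f x - G x) has_field_derivative 0) (at x within unit_disk)" if x: "x \<in> unit_disk" for x
  proof -
    have "(G has_field_derivative exp (\<nu> * Ln (1 - x)) / (1 - x)) (at x)"
      unfolding G_def using nonpos[OF x] \<open>\<nu> \<noteq> 0\<close> by (auto intro!: derivative_eq_intros simp: field_simps)
    moreover have "exp (\<nu> * Ln (1 - x)) / (1 - x) = exp (\<nu> * Ln (1 - x) - Ln (1 - x))"
      using nonpos(2)[OF x] by (simp add: exp_diff)
    moreover have "\<nu> * Ln (1 - x) - Ln (1 - x) = \<gamma> * (c * L x)"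
      by (simp add: \<nu>_def L_def \<delta>_def c_def algebra_simps)
    ultimately have "(G has_field_derivative exp (\<gamma> * (c * L x))) (at x)" by simp
    from DERIV_diff[OF Jop_has_field_derivative[OF hc lq x, of \<gamma>] this]
    show ?thesis by (simp add: has_field_derivative_at_within)
  qed
  then obtain k where k: "\<And>x. x \<in> unit_disk \<Longrightarrow> Jop \<gamma> f x - G x = k"
    using has_field_derivative_zero_constant[OF convex_ball, of 0 1 "\<lambda>x. Jop \<gamma> f x - G x"] by blast
  have "G z1 = G z2" using z(4) by (simp add: G_def)
  then have "Jop \<gamma> f z1 = Jop \<gamma> f z2" using k[OF z(1)] k[OF z(2)] by (simp add: algebra_simps)
  then show False using inj_onD[OF inj] z by blast
qed

lemma exponent_sufficient:
  fixes \<gamma> :: complex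
  assumes \<kappa>: "(1 - l) * cos \<alpha> > 0" and f: "f \<in> spirallike \<alpha> l"
  defines "\<delta> \<equiv> spiral_factor \<alpha> l * \<gamma>"
  assumes \<delta>: "cmod \<delta> \<le> 1 / 2 \<or> (\<exists>x. \<delta> = of_real x \<and> 1 / 2 \<le> x \<and> x \<le> 3 / 2)"
  shows "Jop \<gamma> f \<in> classS"
proof -
  obtain L where L: "L holomorphic_on unit_disk" "L 0 = 0"
    "\<And>z. z \<in> unit_disk \<Longrightarrow> Re (1 + z * deriv L z) > 0"
    "\<And>z. z \<in> unit_disk \<Longrightarrow> logquot f z = spiral_factor \<alpha> l * L z"
    using spirallike_convex_log[OF f \<kappa>] by blast
  have hol: "(\<lambda>z. spiral_factor \<alpha> l * L z) holomorphic_on unit_disk"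
    by (intro holomorphic_intros L)
  have "(Jop \<gamma> f has_field_derivative exp (\<delta> * L z)) (at z)" if "z \<in> unit_disk" for z
    using Jop_has_field_derivative[OF hol L(4) that, of \<gamma>] by (simp add: \<delta>_def mult_ac)
  then have "inj_on (Jop \<gamma> f) unit_disk"
    using univalent_exp_multiple[OF L(1,2,3) _ \<delta>] by blast
  then show ?thesis using Jop_in_classS_iff[OF hol _ L(4)] L(2) by simp
qed

text \<open>Multiplication by \<open>spiral_factor\<close> rotates by \<open>- \<alpha>\<close> and
  scales by \<open>k = (1 - l) * cos \<alpha>\<close>, so
  \<open>\<gamma> = e * \<delta> / k\<close>. The endpoints of the segment correspond to
  \<open>\<delta> = 1 / 2\<close> and \<open>\<delta> = 3 / 2\<close>, at distance 1, so its
  parameter is \<open>u = \<delta> - 1 / 2\<close>.\<close>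

lemma exponent_region:
  fixes \<gamma> :: complex
  assumes \<kappa>: "(1 - l) * cos \<alpha> > 0"
  defines "\<delta> \<equiv> spiral_factor \<alpha> l * \<gamma>"
  shows "\<gamma> \<in> {\<gamma>. cmod \<gamma> \<le> 1 / (2 * (1 - l) * cos \<alpha>)} \<union>
      closed_segment (exp (\<i> * of_real \<alpha>) / of_real (2 * (1 - l) * cos \<alpha>))
                     (3 * exp (\<i> * of_real \<alpha>) / of_real (2 * (1 - l) * cos \<alpha>)) \<longleftrightarrow>
    cmod \<delta> \<le> 1 / 2 \<or> (\<exists>x. \<delta> = of_real x \<and> 1 / 2 \<le> x \<and> x \<le> 3 / 2)"
proof -
  define k where "k = (1 - l) * cos \<alpha>"
  define e where "e = exp (\<i> * of_real \<alpha>)"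
  have k: "k > 0" using \<kappa> by (simp add: k_def)
  have two: "2 * (1 - l) * cos \<alpha> = 2 * k" by (simp add: k_def)
  have "e * exp (- \<i> * of_real \<alpha>) = 1" unfolding e_def by (simp add: exp_add[symmetric])
  moreover have \<delta>: "\<delta> = exp (- \<i> * of_real \<alpha>) * of_real k * \<gamma>"
    by (simp add: \<delta>_def spiral_factor_def k_def)
  ultimately have "e * \<delta> = of_real k * \<gamma>" by (simp add: mult.assoc[symmetric])
  then have \<gamma>: "\<gamma> = e * \<delta> / of_real k" using k by (simp add: field_simps)
  have "cmod \<delta> = k * cmod \<gamma>" using k by (simp add: \<delta> norm_mult)
  then have 1: "cmod \<gamma> \<le> 1 / (2 * k) \<longleftrightarrow> cmod \<delta> \<le> 1 / 2" using k by (simp add: field_simps)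
  have "e \<noteq> 0" by (simp add: e_def)
  have seg: "(1 - u) *\<^sub>R (e / of_real (2 * k)) + u *\<^sub>R (3 * e / of_real (2 * k)) = e * of_real (1 / 2 + u) / of_real k" for u
    using k by (simp add: scaleR_conv_of_real field_simps)
  have "\<gamma> \<in> closed_segment (e / of_real (2 * k)) (3 * e / of_real (2 * k)) \<longleftrightarrow>
      (\<exists>u. 0 \<le> u \<and> u \<le> 1 \<and> \<delta> = of_real (1 / 2 + u))"
    unfolding in_segment seg using k \<open>e \<noteq> 0\<close> by (subst \<gamma>) auto
  also have "\<dots> \<longleftrightarrow> (\<exists>x. \<delta> = of_real x \<and> 1 / 2 \<le> x \<and> x \<le> 3 / 2)"
  proof
    assume "\<exists>x. \<delta> = of_real x \<and> 1 / 2 \<le> x \<and> x \<le> 3 / 2"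
    then obtain x where "\<delta> = of_real x" "1 / 2 \<le> x" "x \<le> 3 / 2" by blast
    then show "\<exists>u. 0 \<le> u \<and> u \<le> 1 \<and> \<delta> = of_real (1 / 2 + u)" by (intro exI[of _ "x - 1 / 2"]) auto
  next
    assume "\<exists>u. 0 \<le> u \<and> u \<le> 1 \<and> \<delta> = of_real (1 / 2 + u)"
    then obtain u where "0 \<le> u" "u \<le> 1" "\<delta> = of_real (1 / 2 + u)" by blast
    then show "\<exists>x. \<delta> = of_real x \<and> 1 / 2 \<le> x \<and> x \<le> 3 / 2" by (intro exI[of _ "1 / 2 + u"]) auto
  qed
  finally show ?thesis unfolding two e_def[symmetric] Un_iff mem_Collect_eq 1 by blast
qed

theorem theorem2p3:
  fixes \<alpha> l :: real
  assumes "-(pi/2) < \<alpha>" and "\<alpha> < pi/2" and "l < 1"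
  shows "{\<gamma>::complex. \<forall>f\<in>spirallike \<alpha> l. Jop \<gamma> f \<in> classS} =
    {\<gamma>. cmod \<gamma> \<le> 1 / (2 * (1 - l) * cos \<alpha>)} \<union>
    closed_segment (exp (\<i> * of_real \<alpha>) / of_real (2 * (1 - l) * cos \<alpha>))
                   (3 * exp (\<i> * of_real \<alpha>) / of_real (2 * (1 - l) * cos \<alpha>))"
proof -
  have \<kappa>: "(1 - l) * cos \<alpha> > 0"
    using assms by (intro mult_pos_pos cos_gt_zero_pi) auto
  have "\<gamma> \<in> {\<gamma>::complex. \<forall>f\<in>spirallike \<alpha> l. Jop \<gamma> f \<in> classS} \<longleftrightarrow>
    cmod (spiral_factor \<alpha> l * \<gamma>) \<le> 1 / 2 \<or>
    (\<exists>x. spiral_factor \<alpha> l * \<gamma> = of_real x \<and> 1 / 2 \<le> x \<and> x \<le> 3 / 2)" for \<gamma>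
    using exponent_necessary[OF \<kappa>, of \<gamma>] exponent_sufficient[OF \<kappa>, of _ \<gamma>]
    unfolding mem_Collect_eq by blast
  then show ?thesis unfolding set_eq_iff exponent_region[OF \<kappa>] by blast
qed

end
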